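(* Let $X$ be an infinite compact space of weight $\tau$. Then $$\mathcal N_e(F(X))=_T\mathcal N_e(A(X))=_T([\tau]^{<\omega})^\omega .$$
   Context: Compact spaces and topological groups are Hausdorff. The weight of $X$ is the least cardinality of a base of its topology. $F(X)$ (resp. $A(X)$) is the Markov free topological group (resp. free Abelian topological group) over $X$: the free group (resp. free Abelian group) on the set $X$ with the finest group topology making the inclusion of $X$ continuous, so that every continuous map from $X$ to a topological group (resp. Abelian topological group) extends uniquely to a continuous homomorphism. $\mathcal N_e(G)$ is the filter of neighbourhoods of the identity of $G$, ordered by reverse inclusion. $[\tau]^{<\omega}$ is the set of finite subsets of $\tau$ ordered by inclusion, and $([\tau]^{<\omega})^\omega$ carries the coordinatewise order. For directed posets $P,Q$, $P\le_T Q$ (Tukey order) means there is a map $Q\to P$ sending cofinal subsets to cofinal subsets (equivalently, a map $P\to Q$ sending unbounded subsets to unbounded subsets, where a set is bounded if it has a single upper bound); $P=_TQ$ means $P\le_TQ$ and $Q\le_TP$. *)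

theory Defs
  imports "HOL-Analysis.Analysis" "HOL-Algebra.Free_Abelian_Groups"
begin

no_notation elt_set_eq (infix \<open>=o\<close> 50)

section \<open>Weight\<close>

definition base_of_topology :: "'a topology \<Rightarrow> 'a set set \<Rightarrow> bool" where
  "base_of_topology X \<B> \<longleftrightarrow>
     (\<forall>V\<in>\<B>. openin X V) \<and>
     (\<forall>U x. openin X U \<and> x \<in> U \<longrightarrow> (\<exists>V\<in>\<B>. x \<in> V \<and> V \<subseteq> U))"

text \<open>
  Cardinals are cardinal orders in the sense of the HOL cardinal library, over any type;
  the set underlying the cardinal \<open>\<tau>\<close> is \<open>Field \<tau>\<close>.
\<close>

definition is_weight :: "'a topology \<Rightarrow> 't rel \<Rightarrow> bool" where
  "is_weight X \<tau> \<longleftrightarrow>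
     Card_order \<tau> \<and>
     (\<exists>\<B>. base_of_topology X \<B> \<and> |\<B>| =o \<tau>) \<and>
     (\<forall>\<B>. base_of_topology X \<B> \<longrightarrow> \<tau> \<le>o |\<B>| )"


section \<open>Tukey order\<close>

text \<open>
  A poset is given by its order relation \<open>r\<close> (a set of pairs); its underlying set is \<open>Field r\<close>.
  The constant \<^const>\<open>cofinal\<close> of the cardinal library is a strict variant (for limit
  well-orders) and is not the notion needed here.
\<close>

definition cofinal_subset :: "'p rel \<Rightarrow> 'p set \<Rightarrow> bool" where
  "cofinal_subset r C \<longleftrightarrow> C \<subseteq> Field r \<and> (\<forall>p\<in>Field r. \<exists>c\<in>C. (p, c) \<in> r)"

definition tukey_le :: "'p rel \<Rightarrow> 'q rel \<Rightarrow> bool"  (infix \<open>\<le>\<^sub>T\<close> 50) where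
  "r \<le>\<^sub>T s \<longleftrightarrow>
     (\<exists>\<phi>. \<phi> ` Field s \<subseteq> Field r \<and>
          (\<forall>C. cofinal_subset s C \<longrightarrow> cofinal_subset r (\<phi> ` C)))"

definition tukey_eq :: "'p rel \<Rightarrow> 'q rel \<Rightarrow> bool"  (infix \<open>=\<^sub>T\<close> 50) where
  "r =\<^sub>T s \<longleftrightarrow> r \<le>\<^sub>T s \<and> s \<le>\<^sub>T r"

definition finite_subsets_order :: "'t set \<Rightarrow> 't set rel" where
  "finite_subsets_order A = relation_of (\<subseteq>) (Fpow A)"

definition omega_power :: "'p rel \<Rightarrow> (nat \<Rightarrow> 'p) rel" where
  "omega_power r = {(f, g). \<forall>n. (f n, g n) \<in> r}"

definition nhds_order :: "'g topology \<Rightarrow> 'g \<Rightarrow> 'g set rel" where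
  "nhds_order T e =
     relation_of (\<supseteq>) {N. N \<subseteq> topspace T \<and> (\<exists>U. openin T U \<and> e \<in> U \<and> U \<subseteq> N)}"


section \<open>The finest group topology\<close>

locale topological_group = group G for G :: "('g, 'm) monoid_scheme" (structure) +
  fixes T :: "'g topology"
  assumes topspace_eq: "topspace T = carrier G"
    and continuous_mult: "continuous_map (prod_topology T T) T (\<lambda>(x, y). x \<otimes> y)"
    and continuous_inv: "continuous_map T T (\<lambda>x. inv x)"
    and Hausdorff: "Hausdorff_space T"

text \<open>
  The topology on \<open>G\<close> generated by all topologies that turn \<open>G\<close> into a topological group and
  make \<open>\<iota>\<close> continuous. As soon as there is one such topology, this is the finest one; see
  \<open>finest_group_topology\<close> and \<open>finest_group_topology_finest\<close> below.
\<close>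

definition finest_group_topology ::
    "'a topology \<Rightarrow> ('g, 'm) monoid_scheme \<Rightarrow> ('a \<Rightarrow> 'g) \<Rightarrow> 'g topology" where
  "finest_group_topology X G \<iota> =
     topology_generated_by
       {U. \<exists>T. topological_group G T \<and> continuous_map X T \<iota> \<and> openin T U}"

lemma openin_finest_group_topology:
  assumes "topological_group G T" "continuous_map X T \<iota>" "openin T U"
  shows "openin (finest_group_topology X G \<iota>) U"
  unfolding finest_group_topology_def
  by (rule topology_generated_by_Basis) (use assms in blast)

lemma finest_group_topology:
  assumes "topological_group G T\<^sub>0" "continuous_map X T\<^sub>0 \<iota>"
  shows "topological_group G (finest_group_topology X G \<iota>)"
    and "continuous_map X (finest_group_topology X G \<iota>) \<iota>"
proof -
  let ?S = "{U. \<exists>T. topological_group G T \<and> continuous_map X T \<iota> \<and> openin T U}"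
  let ?F = "finest_group_topology X G \<iota>"
  interpret T\<^sub>0: topological_group G T\<^sub>0 by fact
  have top: "topspace T = carrier G" if "topological_group G T" for T
    using that by (rule topological_group.topspace_eq)
  have topS: "\<Union>?S = carrier G"
  proof
    show "\<Union>?S \<subseteq> carrier G"
      using top by (auto dest!: openin_subset)
    have "carrier G \<in> ?S"
      using assms T\<^sub>0.topspace_eq by (metis (mono_tags, lifting) mem_Collect_eq openin_topspace)
    then show "carrier G \<subseteq> \<Union>?S" by blast
  qed
  have topF: "topspace ?F = carrier G"
    unfolding finest_group_topology_def by (simp only: topology_generated_by_topspace topS)
  have gen: "continuous_map Y ?F f"
    if "\<And>T. topological_group G T \<Longrightarrow> continuous_map X T \<iota> \<Longrightarrow> continuous_map Y T f" for Y :: "'z topology" and f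
    unfolding finest_group_topology_def
  proof (rule continuous_on_generated_topo)
    show "openin Y (f -` U \<inter> topspace Y)" if "U \<in> ?S" for U
    proof -
      from that obtain T where T: "topological_group G T" "continuous_map X T \<iota>" "openin T U"
        by blast
      have "{x \<in> topspace Y. f x \<in> U} = f -` U \<inter> topspace Y" by blast
      then show ?thesis
        using \<open>\<And>T. _ \<Longrightarrow> _ \<Longrightarrow> continuous_map Y T f\<close>[OF T(1,2)] T(3)
        by (metis openin_continuous_map_preimage)
    qed
    show "f ` topspace Y \<subseteq> \<Union>?S"
      using \<open>\<And>T. _ \<Longrightarrow> _ \<Longrightarrow> continuous_map Y T f\<close>[OF assms] T\<^sub>0.topspace_eq topS
      by (simp add: continuous_map_def Pi_iff image_subset_iff)
  qed
  have idc: "continuous_map ?F T (\<lambda>x. x)"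
    if T: "topological_group G T" "continuous_map X T \<iota>" for T
  proof -
    have "openin ?F {x \<in> carrier G. x \<in> U}" if "openin T U" for U
    proof -
      have "{x \<in> carrier G. x \<in> U} = U"
        using openin_subset[OF that] top[OF T(1)] by blast
      then show ?thesis using openin_finest_group_topology[OF T that] by simp
    qed
    then show ?thesis
      using top[OF T(1)] by (simp add: continuous_map_def topF)
  qed
  show "continuous_map X ?F \<iota>" by (rule gen)
  show "topological_group G ?F"
  proof
    show "topspace ?F = carrier G" by (rule topF)
    show "continuous_map (prod_topology ?F ?F) ?F (\<lambda>(x, y). x \<otimes>\<^bsub>G\<^esub> y)"
    proof (rule gen)
      fix T assume T: "topological_group G T" "continuous_map X T \<iota>"
      have "continuous_map (prod_topology ?F ?F) (prod_topology T T) (\<lambda>z. (fst z, snd z))"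
        unfolding continuous_map_paired
        using continuous_map_compose[OF continuous_map_fst idc[OF T], of ?F]
              continuous_map_compose[OF continuous_map_snd idc[OF T], of ?F]
        unfolding o_def by (rule conjI)
      from continuous_map_compose[OF this topological_group.continuous_mult[OF T(1)]]
      show "continuous_map (prod_topology ?F ?F) T (\<lambda>(x, y). x \<otimes>\<^bsub>G\<^esub> y)"
        by (simp add: o_def case_prod_unfold)
    qed
    show "continuous_map ?F ?F (\<lambda>x. inv\<^bsub>G\<^esub> x)"
    proof (rule gen)
      fix T assume T: "topological_group G T" "continuous_map X T \<iota>"
      from continuous_map_compose[OF idc[OF T] topological_group.continuous_inv[OF T(1)]]
      show "continuous_map ?F T (\<lambda>x. inv\<^bsub>G\<^esub> x)" by (simp add: o_def)
    qed
    show "Hausdorff_space ?F"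
      unfolding Hausdorff_space_def
    proof (intro allI impI)
      fix x y assume "x \<in> topspace ?F \<and> y \<in> topspace ?F \<and> x \<noteq> y"
      then have "x \<in> topspace T\<^sub>0 \<and> y \<in> topspace T\<^sub>0 \<and> x \<noteq> y"
        unfolding topF T\<^sub>0.topspace_eq .
      then obtain U V where UV: "openin T\<^sub>0 U" "openin T\<^sub>0 V" "x \<in> U" "y \<in> V" "disjnt U V"
        using T\<^sub>0.Hausdorff[unfolded Hausdorff_space_def, rule_format, of x y] by blast
      show "\<exists>U V. openin ?F U \<and> openin ?F V \<and> x \<in> U \<and> y \<in> V \<and> disjnt U V"
        using openin_finest_group_topology[OF assms UV(1)]
              openin_finest_group_topology[OF assms UV(2)] UV(3-5)
        by (intro exI[of _ U] exI[of _ V] conjI)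
    qed
  qed
qed

lemma finest_group_topology_finest:
  assumes "topological_group G T" "continuous_map X T \<iota>"
  shows "continuous_map (finest_group_topology X G \<iota>) T id"
proof -
  have top: "topspace (finest_group_topology X G \<iota>) = topspace T"
    using finest_group_topology(1)[OF assms] assms(1) by (simp add: topological_group.topspace_eq)
  have "openin (finest_group_topology X G \<iota>) {x \<in> topspace T. x \<in> U}" if "openin T U" for U
  proof -
    have "{x \<in> topspace T. x \<in> U} = U" using openin_subset[OF that] by blast
    then show ?thesis using openin_finest_group_topology[OF assms that] by simp
  qed
  then show ?thesis by (simp add: continuous_map_def top)
qed


section \<open>Free groups\<close>

text \<open>
  A letter \<open>(x, True)\<close> stands for the generator \<open>x\<close>, and \<open>(x, False)\<close> for its inverse.
\<close>

definition flip_letter :: "'a \<times> bool \<Rightarrow> 'a \<times> bool" where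
  "flip_letter a = (fst a, \<not> snd a)"

definition reduced_word :: "('a \<times> bool) list \<Rightarrow> bool" where
  "reduced_word w \<longleftrightarrow> successively (\<lambda>a b. b \<noteq> flip_letter a) w"

definition push_letter :: "'a \<times> bool \<Rightarrow> ('a \<times> bool) list \<Rightarrow> ('a \<times> bool) list" where
  "push_letter a w = (if w \<noteq> [] \<and> hd w = flip_letter a then tl w else a # w)"

definition free_group :: "'a set \<Rightarrow> ('a \<times> bool) list monoid" where
  "free_group S =
     \<lparr>carrier = {w. reduced_word w \<and> fst ` set w \<subseteq> S},
      monoid.mult = (\<lambda>u v. foldr push_letter u v),
      one = []\<rparr>"

definition free_gen :: "'a \<Rightarrow> ('a \<times> bool) list" where
  "free_gen x = [(x, True)]"

lemma flip_flip [simp]: "flip_letter (flip_letter a) = a"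
  by (simp add: flip_letter_def)

lemma fst_flip [simp]: "fst (flip_letter a) = fst a"
  by (simp add: flip_letter_def)

lemma reduced_Nil [simp]: "reduced_word []"
  by (simp add: reduced_word_def)

lemma reduced_Cons: "reduced_word (a # w) \<longleftrightarrow> reduced_word w \<and> (w = [] \<or> hd w \<noteq> flip_letter a)"
  by (auto simp: reduced_word_def successively_Cons)

lemma reduced_push: "reduced_word w \<Longrightarrow> reduced_word (push_letter a w)"
  by (cases w) (auto simp: push_letter_def reduced_Cons)

lemma reduced_foldr_push: "reduced_word w \<Longrightarrow> reduced_word (foldr push_letter u w)"
  by (induction u) (auto simp: reduced_push)

lemma push_flip: "reduced_word w \<Longrightarrow> push_letter a (push_letter (flip_letter a) w) = w"
  by (cases w) (auto simp: push_letter_def reduced_Cons neq_Nil_conv)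

lemma foldr_push_push:
  assumes "reduced_word v"
  shows "foldr push_letter (push_letter a u) v = push_letter a (foldr push_letter u v)"
proof (cases "u \<noteq> [] \<and> hd u = flip_letter a")
  case True
  then obtain w where "u = flip_letter a # w" by (cases u) auto
  then show ?thesis
    using push_flip[OF reduced_foldr_push[OF assms]] by (simp add: push_letter_def)
next
  case False
  then have "push_letter a u = a # u" by (auto simp: push_letter_def)
  then show ?thesis by simp
qed

lemma foldr_push_assoc:
  "reduced_word w \<Longrightarrow>
   foldr push_letter (foldr push_letter u v) w = foldr push_letter u (foldr push_letter v w)"
  by (induction u) (auto simp: foldr_push_push)

lemma fst_set_push:
  "fst a \<in> S \<Longrightarrow> fst ` set w \<subseteq> S \<Longrightarrow> fst ` set (push_letter a w) \<subseteq> S"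
  by (cases w) (simp_all add: push_letter_def)

lemma fst_set_foldr_push:
  assumes "fst ` set u \<subseteq> S" "fst ` set w \<subseteq> S"
  shows "fst ` set (foldr push_letter u w) \<subseteq> S"
  using assms(1)
proof (induction u)
  case Nil
  show ?case using assms(2) by simp
next
  case (Cons a u)
  then have "fst a \<in> S" "fst ` set (foldr push_letter u w) \<subseteq> S" by simp_all
  then show ?case unfolding foldr_Cons comp_apply by (rule fst_set_push)
qed

lemma foldr_push_inverse:
  "foldr push_letter (rev (map flip_letter u)) u = []"
  by (induction u) (auto simp: push_letter_def)

lemma reduced_inverse: "reduced_word u \<Longrightarrow> reduced_word (rev (map flip_letter u))"
  unfolding reduced_word_def successively_rev successively_map
  by (erule successively_mono) auto

lemma group_free_group: "group (free_group S)"
proof (rule groupI)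
  fix u v w
  assume uvw: "u \<in> carrier (free_group S)" "v \<in> carrier (free_group S)" "w \<in> carrier (free_group S)"
  show "u \<otimes>\<^bsub>free_group S\<^esub> v \<otimes>\<^bsub>free_group S\<^esub> w = u \<otimes>\<^bsub>free_group S\<^esub> (v \<otimes>\<^bsub>free_group S\<^esub> w)"
    using uvw by (simp add: free_group_def foldr_push_assoc)
next
  fix u v
  assume "u \<in> carrier (free_group S)" "v \<in> carrier (free_group S)"
  then show "u \<otimes>\<^bsub>free_group S\<^esub> v \<in> carrier (free_group S)"
    by (simp add: free_group_def reduced_foldr_push fst_set_foldr_push)
next
  fix u
  assume u: "u \<in> carrier (free_group S)"
  have "rev (map flip_letter u) \<in> carrier (free_group S)"
    using u by (auto simp: free_group_def reduced_inverse)
  moreover have "rev (map flip_letter u) \<otimes>\<^bsub>free_group S\<^esub> u = \<one>\<^bsub>free_group S\<^esub>"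
    by (simp add: free_group_def foldr_push_inverse)
  ultimately show "\<exists>y\<in>carrier (free_group S). y \<otimes>\<^bsub>free_group S\<^esub> u = \<one>\<^bsub>free_group S\<^esub>"
    by blast
qed (auto simp: free_group_def)

text \<open>The universal property of the free group (existence and uniqueness of extensions).\<close>

lemma free_group_universal:
  fixes H :: "('h, 'm) monoid_scheme" and S :: "'a set"
  assumes "group H" "f \<in> S \<rightarrow> carrier H"
  shows "\<exists>h\<in>hom (free_group S) H. \<forall>x\<in>S. h (free_gen x) = f x"
    and "\<lbrakk>h \<in> hom (free_group S) H; h' \<in> hom (free_group S) H;
          \<forall>x\<in>S. h (free_gen x) = h' (free_gen x); w \<in> carrier (free_group S)\<rbrakk> \<Longrightarrow> h w = h' w"
proof -
  interpret H: group H by fact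
  define l where "l a = (if snd a then f (fst a) else inv\<^bsub>H\<^esub> f (fst a))" for a :: "'a \<times> bool"
  define k where "k w = foldr (\<lambda>a y. l a \<otimes>\<^bsub>H\<^esub> y) w \<one>\<^bsub>H\<^esub>" for w
  have l: "l a \<in> carrier H" if "fst a \<in> S" for a
    using that assms(2) by (auto simp: l_def)
  have k: "k w \<in> carrier H" if "fst ` set w \<subseteq> S" for w
    using that by (induction w) (auto simp: k_def l)
  have lf: "l a \<otimes>\<^bsub>H\<^esub> (l (flip_letter a) \<otimes>\<^bsub>H\<^esub> y) = y" if "fst a \<in> S" "y \<in> carrier H" for a y
  proof -
    have "f (fst a) \<in> carrier H" using that assms(2) by auto
    then show ?thesis
      using that by (simp add: l_def flip_letter_def H.m_assoc[symmetric])
  qed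
  have kp: "k (push_letter a w) = l a \<otimes>\<^bsub>H\<^esub> k w" if "fst a \<in> S" "fst ` set w \<subseteq> S" for a w
  proof (cases "w \<noteq> [] \<and> hd w = flip_letter a")
    case True
    then obtain v where v: "w = flip_letter a # v" by (cases w) auto
    then have "k v \<in> carrier H" using that k by auto
    then show ?thesis using lf[OF that(1)] v by (simp add: push_letter_def k_def)
  next
    case False
    then show ?thesis by (auto simp add: push_letter_def k_def)
  qed
  have km: "k (foldr push_letter u v) = k u \<otimes>\<^bsub>H\<^esub> k v"
    if "fst ` set u \<subseteq> S" "fst ` set v \<subseteq> S" for u v
    using that
  proof (induction u)
    case Nil
    then show ?case using k[of v] by (simp add: k_def)
  next
    case (Cons a u)
    have "fst ` set (foldr push_letter u v) \<subseteq> S"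
      by (intro fst_set_foldr_push) (use Cons.prems in auto)
    then have "k (foldr push_letter (a # u) v) = l a \<otimes>\<^bsub>H\<^esub> (k u \<otimes>\<^bsub>H\<^esub> k v)"
      using kp[of a] Cons by simp
    also have "\<dots> = (l a \<otimes>\<^bsub>H\<^esub> k u) \<otimes>\<^bsub>H\<^esub> k v"
      using Cons.prems by (intro H.m_assoc[symmetric] l k) auto
    finally show ?case by (simp add: k_def)
  qed
  have "k \<in> hom (free_group S) H"
    by (rule homI) (auto simp: free_group_def k km)
  moreover have "\<forall>x\<in>S. k (free_gen x) = f x"
  proof
    fix x assume "x \<in> S"
    then have "f x \<in> carrier H" using assms(2) by blast
    then show "k (free_gen x) = f x" by (simp add: k_def free_gen_def l_def)
  qed
  ultimately show "\<exists>h\<in>hom (free_group S) H. \<forall>x\<in>S. h (free_gen x) = f x" by blast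
  assume h: "h \<in> hom (free_group S) H" "h' \<in> hom (free_group S) H"
    and eq: "\<forall>x\<in>S. h (free_gen x) = h' (free_gen x)" and w: "w \<in> carrier (free_group S)"
  interpret F: group "free_group S" by (rule group_free_group)
  interpret h: group_hom "free_group S" H h using h by unfold_locales
  interpret h': group_hom "free_group S" H h' using h by unfold_locales
  have one: "[a] \<in> carrier (free_group S)" if "fst a \<in> S" for a
    using that by (simp add: free_group_def reduced_Cons)
  have letter: "h [a] = h' [a]" if "fst a \<in> S" for a
  proof (cases a)
    case (Pair x b)
    have x: "free_gen x \<in> carrier (free_group S)" and xS: "x \<in> S"
      using one[of "(x, True)"] that Pair by (auto simp: free_gen_def)
    have "inv\<^bsub>free_group S\<^esub> free_gen x = [(x, False)]"
    proof (rule F.inv_equality)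
      show "[(x, False)] \<otimes>\<^bsub>free_group S\<^esub> free_gen x = \<one>\<^bsub>free_group S\<^esub>"
        by (simp add: free_group_def free_gen_def push_letter_def flip_letter_def)
    qed (use x one[of "(x, False)"] xS in auto)
    then have "h [(x, False)] = inv\<^bsub>H\<^esub> h (free_gen x)" "h' [(x, False)] = inv\<^bsub>H\<^esub> h' (free_gen x)"
      using h.hom_inv[OF x] h'.hom_inv[OF x] by auto
    then show ?thesis using eq xS Pair by (cases b) (auto simp: free_gen_def)
  qed
  show "h w = h' w"
    using w
  proof (induction w)
    case Nil
    then show ?case using h.hom_one h'.hom_one by (simp add: free_group_def)
  next
    case (Cons a w)
    then have a: "fst a \<in> S" and w: "w \<in> carrier (free_group S)"
      and "a # w = [a] \<otimes>\<^bsub>free_group S\<^esub> w"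
      by (auto simp: free_group_def reduced_Cons push_letter_def)
    then show ?case
      using h.hom_mult[OF one[OF a] w] h'.hom_mult[OF one[OF a] w] Cons.IH letter[OF a] by simp
  qed
qed


section \<open>Markov free topological groups\<close>

definition markov_free_topology :: "'a topology \<Rightarrow> ('a \<times> bool) list topology" where
  "markov_free_topology X = finest_group_topology X (free_group (topspace X)) free_gen"

definition markov_free_abelian_topology :: "'a topology \<Rightarrow> ('a \<Rightarrow>\<^sub>0 int) topology" where
  "markov_free_abelian_topology X =
     finest_group_topology X (free_Abelian_group (topspace X)) frag_of"

end

theory Submission
  imports Defs
begin

text \<open>
  Let \<open>G\<close> be \<open>F(X)\<close> or \<open>A(X)\<close>. For a sequence \<open>U\<close> of entourages of \<open>X\<close> consider the products,
  in any order, of elements \<open>a\<^sub>n = g x\<inverse> y g\<inverse>\<close> with distinct indices \<open>n\<close>, where \<open>(x, y) \<in> U\<^sub>n\<close>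
  and \<open>g\<close> is a word of length at most \<open>n\<close>. Since \<open>X\<close> is compact, these sets form a base at the
  identity of the finest group topology. Entourages are governed by finite sets of pairs of basic
  open sets, so \<open>([\<tau>]\<^sup><\<^sup>\<omega>)\<^sup>\<omega>\<close> lies above the neighbourhood filter.

  Conversely, let \<open>S\<close> be a maximal \<open>1/3\<close>-separated set of continuous functions
  \<open>X \<rightarrow> [0, 1]\<close>. The sets \<open>{s > 1/2}\<close>, \<open>s \<in> S\<close>, form a base, so \<open>S\<close> has at least \<open>\<tau>\<close> elements.
  Extend each \<open>s\<close> to a homomorphism \<open>h s\<close> from \<open>G\<close> to the reals, and send a sequence \<open>F\<close> of finite
  subsets of \<open>S\<close> to the neighbourhood \<open>{g. \<forall>m. \<forall>s\<in>F m. \<bar>h s g\<bar> \<le> 2\<^sup>m}\<close>. If it contains a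
  neighbourhood \<open>N\<close>, every \<open>s \<in> F m\<close> varies by at most \<open>1/16\<close> on the entourage of all \<open>(x, y)\<close>
  for which the power of \<open>x\<inverse> y\<close> with exponent \<open>2\<^sup>m\<^sup>+\<^sup>4\<close> is in \<open>N\<close>. Only finitely many elements
  of \<open>S\<close> do so, which bounds \<open>F m\<close> in terms of \<open>N\<close>.

  The topologies are Hausdorff because homomorphisms to the reals, respectively to the group of
  real two by two matrices of determinant one, separate points.
\<close>

section \<open>Tukey reductions\<close>

text \<open>A Galois-Tukey connection: a set \<open>C\<close> cofinal in \<open>s\<close> contains
  some \<open>q\<close> above \<open>\<psi> p\<close>, and then \<open>\<phi> q\<close> lies above
  \<open>p\<close>.\<close>

lemma tukey_leI:
  assumes "\<And>p. p \<in> Field r \<Longrightarrow> \<psi> p \<in> Field s"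
    and "\<And>q. q \<in> Field s \<Longrightarrow> \<phi> q \<in> Field r"
    and "\<And>p q. \<lbrakk>p \<in> Field r; q \<in> Field s; (\<psi> p, q) \<in> s\<rbrakk> \<Longrightarrow> (p, \<phi> q) \<in> r"
  shows "r \<le>\<^sub>T s"
  unfolding tukey_le_def
proof (intro exI[of _ \<phi>] conjI allI impI)
  show "\<phi> ` Field s \<subseteq> Field r" using assms(2) by blast
  fix C assume C: "cofinal_subset s C"
  have "\<exists>c\<in>\<phi> ` C. (p, c) \<in> r" if p: "p \<in> Field r" for p
  proof -
    obtain q where "q \<in> C" "(\<psi> p, q) \<in> s"
      using C assms(1)[OF p] unfolding cofinal_subset_def by blast
    then show ?thesis
      using C assms(3)[OF p] unfolding cofinal_subset_def by blast
  qed
  then show "cofinal_subset r (\<phi> ` C)"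
    using C assms(2) unfolding cofinal_subset_def by blast
qed

lemma tukey_le_trans [trans]:
  assumes "r \<le>\<^sub>T s" "s \<le>\<^sub>T t"
  shows "r \<le>\<^sub>T t"
proof -
  obtain f where f: "f ` Field s \<subseteq> Field r" "\<And>C. cofinal_subset s C \<Longrightarrow> cofinal_subset r (f ` C)"
    using assms(1) unfolding tukey_le_def by blast
  obtain g where g: "g ` Field t \<subseteq> Field s" "\<And>C. cofinal_subset t C \<Longrightarrow> cofinal_subset s (g ` C)"
    using assms(2) unfolding tukey_le_def by blast
  have "(f \<circ> g) ` Field t \<subseteq> Field r"
    using f(1) g(1) by auto
  moreover have "cofinal_subset r ((f \<circ> g) ` C)" if "cofinal_subset t C" for C
    using f(2)[OF g(2)[OF that]] by (simp add: image_comp)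
  ultimately show ?thesis
    unfolding tukey_le_def by blast
qed

lemma Field_relation_of:
  assumes "\<And>x. x \<in> A \<Longrightarrow> P x x"
  shows "Field (relation_of P A) = A"
  using assms by (auto simp: relation_of_def Field_def)

lemma Field_omega_power_finite_subsets:
  "Field (omega_power (finite_subsets_order A)) = {f. \<forall>n. f n \<in> Fpow A}"
  by (auto simp: omega_power_def finite_subsets_order_def relation_of_def Field_def)

lemma omega_power_finite_subsets_iff:
  "(f, g) \<in> omega_power (finite_subsets_order A) \<longleftrightarrow>
     (\<forall>n. f n \<in> Fpow A \<and> g n \<in> Fpow A \<and> f n \<subseteq> g n)"
  by (auto simp: omega_power_def finite_subsets_order_def relation_of_def)

text \<open>An injection \<open>j\<close> acts on sequences of finite sets by images in one
  direction and by preimages in the other. Preimages remain finite because \<open>j\<close> is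
  injective on \<open>A\<close>.\<close>

lemma omega_power_finite_subsets_mono:
  assumes "|A| \<le>o |B|"
  shows "omega_power (finite_subsets_order A) \<le>\<^sub>T omega_power (finite_subsets_order B)"
proof -
  obtain j where j: "inj_on j A" "j ` A \<subseteq> B"
    using assms unfolding card_of_ordLeq[symmetric] by blast
  show ?thesis
  proof (rule tukey_leI[where \<psi> = "\<lambda>f n. j ` f n" and \<phi> = "\<lambda>g n. {a \<in> A. j a \<in> g n}"])
    fix q assume q: "q \<in> Field (omega_power (finite_subsets_order B))"
    have fin: "finite {a \<in> A. j a \<in> q n}" for n
    proof (rule inj_on_finite[of j])
      show "inj_on j {a \<in> A. j a \<in> q n}"
        using j(1) by (rule inj_on_subset) blast
      show "finite (q n)"
        using q unfolding Field_omega_power_finite_subsets Fpow_def by blast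
    qed blast
    show "(\<lambda>n. {a \<in> A. j a \<in> q n}) \<in> Field (omega_power (finite_subsets_order A))"
      using fin unfolding Field_omega_power_finite_subsets Fpow_def by blast
    fix p assume p: "((\<lambda>n. j ` p n), q) \<in> omega_power (finite_subsets_order B)"
      and "p \<in> Field (omega_power (finite_subsets_order A))"
    then have "p n \<in> Fpow A" for n
      unfolding Field_omega_power_finite_subsets by blast
    moreover have "j ` p n \<subseteq> q n" for n
      using p unfolding omega_power_finite_subsets_iff by blast
    ultimately show "(p, \<lambda>n. {a \<in> A. j a \<in> q n}) \<in> omega_power (finite_subsets_order A)"
      using fin unfolding omega_power_finite_subsets_iff Fpow_def by blast
  next
    fix p assume "p \<in> Field (omega_power (finite_subsets_order A))"
    then show "(\<lambda>n. j ` p n) \<in> Field (omega_power (finite_subsets_order B))"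
      using j(2) unfolding Field_omega_power_finite_subsets Fpow_def by blast
  qed
qed

lemma Field_nhds_order:
  "Field (nhds_order T e) = {N. N \<subseteq> topspace T \<and> (\<exists>U. openin T U \<and> e \<in> U \<and> U \<subseteq> N)}"
  unfolding nhds_order_def by (rule Field_relation_of) blast

lemma nhds_order_iff:
  "(M, N) \<in> nhds_order T e \<longleftrightarrow> M \<in> Field (nhds_order T e) \<and> N \<in> Field (nhds_order T e) \<and> N \<subseteq> M"
  unfolding Field_nhds_order by (auto simp: nhds_order_def relation_of_def)


section \<open>Group topologies\<close>

lemma continuous_map_pointwise:
  assumes "\<And>x U. \<lbrakk>x \<in> topspace X; openin Y U; f x \<in> U\<rbrakk>
             \<Longrightarrow> \<exists>V. openin X V \<and> x \<in> V \<and> (\<forall>y\<in>V. f y \<in> U)"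
    and "f \<in> topspace X \<rightarrow> topspace Y"
  shows "continuous_map X Y f"
proof -
  have "f x \<in> topspace Y" if "x \<in> topspace X" for x
    using assms(2) that by blast
  then show ?thesis
    unfolding continuous_map_eq_topcontinuous_at topcontinuous_at_def using assms(1) by simp
qed

section \<open>Group topologies from neighbourhood bases at the identity\<close>

context group
begin

lemma inv_mult_cancel:
  assumes "x \<in> carrier G" "y \<in> carrier G"
  shows "inv x \<otimes> (x \<otimes> y) = y" "x \<otimes> (inv x \<otimes> y) = y"
  using assms by (simp_all add: m_assoc[symmetric])

text \<open>Openness is tested by left translates. The constructor \<open>topology\<close> returns
  these open sets only once they are known to form a topology, which uses that the base is directed;
  hence later proofs go through \<open>openin_filter_topology\<close>.\<close>

definition filter_topology :: "'a set set \<Rightarrow> 'a topology" where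
  "filter_topology \<F> =
     topology (\<lambda>U. U \<subseteq> carrier G \<and> (\<forall>g\<in>U. \<exists>V\<in>\<F>. \<forall>v\<in>V. g \<otimes> v \<in> U))"

text \<open>The usual axioms for a neighbourhood base at the identity of a group topology.
  Separation is kept apart and enters later as
  \<open>\<Inter>\<F> \<subseteq> {\<one>}\<close>.\<close>

definition group_filter_base :: "'a set set \<Rightarrow> bool" where
  "group_filter_base \<F> \<longleftrightarrow>
     \<F> \<noteq> {} \<and> (\<forall>V\<in>\<F>. \<one> \<in> V \<and> V \<subseteq> carrier G) \<and>
     (\<forall>V\<in>\<F>. \<forall>W\<in>\<F>. \<exists>Z\<in>\<F>. Z \<subseteq> V \<inter> W) \<and>
     (\<forall>V\<in>\<F>. \<exists>W\<in>\<F>. \<forall>v\<in>W. \<forall>w\<in>W. v \<otimes> w \<in> V) \<and>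
     (\<forall>V\<in>\<F>. \<exists>W\<in>\<F>. \<forall>w\<in>W. inv w \<in> V) \<and>
     (\<forall>V\<in>\<F>. \<forall>g\<in>carrier G. \<exists>W\<in>\<F>. \<forall>w\<in>W. g \<otimes> w \<otimes> inv g \<in> V)"

lemma
  assumes "group_filter_base \<F>"
  shows group_filter_base_ne: "\<F> \<noteq> {}"
    and group_filter_base_one: "V \<in> \<F> \<Longrightarrow> \<one> \<in> V"
    and group_filter_base_carrier: "V \<in> \<F> \<Longrightarrow> V \<subseteq> carrier G"
    and group_filter_base_Int: "V \<in> \<F> \<Longrightarrow> W \<in> \<F> \<Longrightarrow> \<exists>Z\<in>\<F>. Z \<subseteq> V \<inter> W"
    and group_filter_base_mult: "V \<in> \<F> \<Longrightarrow> \<exists>W\<in>\<F>. \<forall>v\<in>W. \<forall>w\<in>W. v \<otimes> w \<in> V"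
    and group_filter_base_inv: "V \<in> \<F> \<Longrightarrow> \<exists>W\<in>\<F>. \<forall>w\<in>W. inv w \<in> V"
    and group_filter_base_conj:
      "V \<in> \<F> \<Longrightarrow> g \<in> carrier G \<Longrightarrow> \<exists>W\<in>\<F>. \<forall>w\<in>W. g \<otimes> w \<otimes> inv g \<in> V"
  using assms unfolding group_filter_base_def by simp_all

lemma openin_filter_topology:
  assumes "group_filter_base \<F>"
  shows "openin (filter_topology \<F>) U \<longleftrightarrow>
           U \<subseteq> carrier G \<and> (\<forall>g\<in>U. \<exists>V\<in>\<F>. \<forall>v\<in>V. g \<otimes> v \<in> U)"
proof -
  have "istopology (\<lambda>U. U \<subseteq> carrier G \<and> (\<forall>g\<in>U. \<exists>V\<in>\<F>. \<forall>v\<in>V. g \<otimes> v \<in> U))"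
    unfolding istopology_def
  proof (intro conjI allI impI ballI)
    fix S T g
    assume S: "S \<subseteq> carrier G \<and> (\<forall>g\<in>S. \<exists>V\<in>\<F>. \<forall>v\<in>V. g \<otimes> v \<in> S)"
      and T: "T \<subseteq> carrier G \<and> (\<forall>g\<in>T. \<exists>V\<in>\<F>. \<forall>v\<in>V. g \<otimes> v \<in> T)"
      and g: "g \<in> S \<inter> T"
    obtain V where V: "V \<in> \<F>" "\<forall>v\<in>V. g \<otimes> v \<in> S"
      using S g by blast
    obtain W where W: "W \<in> \<F>" "\<forall>v\<in>W. g \<otimes> v \<in> T"
      using T g by blast
    obtain Z where "Z \<in> \<F>" "Z \<subseteq> V \<inter> W"
      using group_filter_base_Int[OF assms V(1) W(1)] by blast
    then show "\<exists>V\<in>\<F>. \<forall>v\<in>V. g \<otimes> v \<in> S \<inter> T"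
      using V W by blast
  next
    fix \<K> g
    assume *: "\<forall>S\<in>\<K>. S \<subseteq> carrier G \<and> (\<forall>g\<in>S. \<exists>V\<in>\<F>. \<forall>v\<in>V. g \<otimes> v \<in> S)"
      "g \<in> \<Union>\<K>"
    then obtain S where "S \<in> \<K>" "g \<in> S" by blast
    moreover obtain V where "V \<in> \<F>" "\<forall>v\<in>V. g \<otimes> v \<in> S"
      using * \<open>S \<in> \<K>\<close> \<open>g \<in> S\<close> by meson
    ultimately show "\<exists>V\<in>\<F>. \<forall>v\<in>V. g \<otimes> v \<in> \<Union>\<K>" by blast
  qed blast+
  then show ?thesis
    by (simp add: filter_topology_def topology_inverse')
qed

lemma topspace_filter_topology:
  assumes "group_filter_base \<F>"
  shows "topspace (filter_topology \<F>) = carrier G"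
proof
  show "topspace (filter_topology \<F>) \<subseteq> carrier G"
    using openin_filter_topology[OF assms] openin_topspace by blast
  obtain V where V: "V \<in> \<F>" using group_filter_base_ne[OF assms] by blast
  have "openin (filter_topology \<F>) (carrier G)"
    unfolding openin_filter_topology[OF assms]
    using V group_filter_base_carrier[OF assms V] by blast
  then show "carrier G \<subseteq> topspace (filter_topology \<F>)" by (rule openin_subset)
qed

text \<open>The translate of \<open>V\<close> by \<open>g\<close> need not be open, so its interior
  is taken: the points \<open>h\<close> whose translate of some \<open>W\<close> stays inside. This
  interior is open because \<open>W\<close> contains all products of two elements of some
  \<open>Z\<close>.\<close>

lemma filter_topology_translate:
  assumes "group_filter_base \<F>" "V \<in> \<F>" "g \<in> carrier G"
  obtains U where "openin (filter_topology \<F>) U" "g \<in> U"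
    "\<And>h. h \<in> U \<Longrightarrow> \<exists>v\<in>V. h = g \<otimes> v"
proof
  let ?gV = "(\<lambda>v. g \<otimes> v) ` V"
  let ?U = "{h \<in> carrier G. \<exists>W\<in>\<F>. \<forall>w\<in>W. h \<otimes> w \<in> ?gV}"
  note one = group_filter_base_one[OF assms(1)]
  note car = group_filter_base_carrier[OF assms(1)]
  show "openin (filter_topology \<F>) ?U"
    unfolding openin_filter_topology[OF assms(1)]
  proof (intro conjI ballI)
    fix h assume "h \<in> ?U"
    then obtain W where h: "h \<in> carrier G" and W: "W \<in> \<F>" "\<forall>w\<in>W. h \<otimes> w \<in> ?gV" by blast
    obtain Z where Z: "Z \<in> \<F>" "\<forall>v\<in>Z. \<forall>w\<in>Z. v \<otimes> w \<in> W"
      using group_filter_base_mult[OF assms(1) W(1)] by blast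
    have "h \<otimes> z \<in> ?U" if z: "z \<in> Z" for z
    proof -
      have "h \<otimes> z \<otimes> w \<in> ?gV" if w: "w \<in> Z" for w
      proof -
        have "h \<otimes> z \<otimes> w = h \<otimes> (z \<otimes> w)"
          using w z h car[OF Z(1)] by (intro m_assoc) blast+
        moreover have "z \<otimes> w \<in> W" using Z(2) w z by blast
        ultimately show ?thesis using W(2) by simp
      qed
      moreover have "h \<otimes> z \<in> carrier G" using h z car[OF Z(1)] by blast
      ultimately show ?thesis using Z(1) by blast
    qed
    then show "\<exists>V\<in>\<F>. \<forall>v\<in>V. h \<otimes> v \<in> ?U" using Z(1) by blast
  qed blast
  show "g \<in> ?U" using assms(2,3) by blast
  fix h assume "h \<in> ?U"
  then obtain W where "h \<in> carrier G" "W \<in> \<F>" "\<forall>w\<in>W. h \<otimes> w \<in> ?gV" by blast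
  then have "h \<in> ?gV" using one by (metis r_one)
  then show "\<exists>v\<in>V. h = g \<otimes> v" by blast
qed

lemma topological_group_filter_topology:
  assumes fb: "group_filter_base \<F>" and sep: "\<Inter>\<F> \<subseteq> {\<one>}"
  shows "topological_group G (filter_topology \<F>)"
proof
  let ?T = "filter_topology \<F>"
  note op = openin_filter_topology[OF fb] and top = topspace_filter_topology[OF fb]
  note car = group_filter_base_carrier[OF fb, THEN subsetD]
  show "topspace ?T = carrier G" by (rule top)
  show "continuous_map (prod_topology ?T ?T) ?T (\<lambda>(x, y). x \<otimes> y)"
  proof (rule continuous_map_pointwise)
    fix p U assume p: "p \<in> topspace (prod_topology ?T ?T)" and U: "openin ?T U"
      and pU: "(\<lambda>(x, y). x \<otimes> y) p \<in> U"
    obtain a b where ab: "p = (a, b)" "a \<in> carrier G" "b \<in> carrier G" "a \<otimes> b \<in> U"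
      using p pU top by auto
    obtain V where V: "V \<in> \<F>" "\<forall>v\<in>V. a \<otimes> b \<otimes> v \<in> U"
      using U ab(4) op by blast
    obtain W where W: "W \<in> \<F>" "\<forall>v\<in>W. \<forall>w\<in>W. v \<otimes> w \<in> V"
      using group_filter_base_mult[OF fb V(1)] by blast
    \<comment> \<open>In the product of \<open>a \<otimes> z\<close> and
      \<open>b \<otimes> w\<close> the factor \<open>z\<close> has to move past \<open>b\<close>,
      which turns it into \<open>inv b \<otimes> z \<otimes> b\<close>.\<close>
    obtain Z where Z: "Z \<in> \<F>" "\<forall>z\<in>Z. inv b \<otimes> z \<otimes> b \<in> W"
      using group_filter_base_conj[OF fb W(1), of "inv b"] ab(3) by auto
    obtain A where A: "openin ?T A" "a \<in> A" "\<And>h. h \<in> A \<Longrightarrow> \<exists>z\<in>Z. h = a \<otimes> z"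
      using filter_topology_translate[OF fb Z(1) ab(2)] by metis
    obtain B where B: "openin ?T B" "b \<in> B" "\<And>h. h \<in> B \<Longrightarrow> \<exists>w\<in>W. h = b \<otimes> w"
      using filter_topology_translate[OF fb W(1) ab(3)] by metis
    have "x \<otimes> y \<in> U" if xA: "x \<in> A" and yB: "y \<in> B" for x y
    proof -
      obtain z w where zw: "z \<in> Z" "w \<in> W" "x = a \<otimes> z" "y = b \<otimes> w"
        using A(3)[OF xA] B(3)[OF yB] by blast
      have c: "z \<in> carrier G" "w \<in> carrier G"
        using zw car Z(1) W(1) by blast+
      have "x \<otimes> y = a \<otimes> b \<otimes> (inv b \<otimes> z \<otimes> b \<otimes> w)"
        unfolding zw(3,4) using ab(2,3) c by (simp add: m_assoc inv_mult_cancel)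
      moreover have "inv b \<otimes> z \<otimes> b \<otimes> w \<in> V" using W(2) Z(2) zw(1,2) by blast
      ultimately show ?thesis using V(2) by metis
    qed
    then show "\<exists>V. openin (prod_topology ?T ?T) V \<and> p \<in> V \<and> (\<forall>y\<in>V. (\<lambda>(x, y). x \<otimes> y) y \<in> U)"
      using A(1,2) B(1,2) ab(1) by (intro exI[of _ "A \<times> B"]) (simp add: openin_prod_Times_iff)
  next
    show "(\<lambda>(x, y). x \<otimes> y) \<in> topspace (prod_topology ?T ?T) \<rightarrow> topspace ?T"
      by (simp add: top Pi_iff)
  qed
  show "continuous_map ?T ?T (\<lambda>x. inv x)"
  proof (rule continuous_map_pointwise)
    fix a U assume a: "a \<in> topspace ?T" and U: "openin ?T U" and aU: "inv a \<in> U"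
    have aG: "a \<in> carrier G" using a top by simp
    obtain V where V: "V \<in> \<F>" "\<forall>v\<in>V. inv a \<otimes> v \<in> U" using U aU op by blast
    \<comment> \<open>The inverse of \<open>a \<otimes> z\<close> is \<open>inv a\<close> times the
      conjugate of \<open>inv z\<close> by \<open>a\<close>.\<close>
    obtain W where W: "W \<in> \<F>" "\<forall>w\<in>W. a \<otimes> w \<otimes> inv a \<in> V"
      using group_filter_base_conj[OF fb V(1) aG] by blast
    obtain Z where Z: "Z \<in> \<F>" "\<forall>z\<in>Z. inv z \<in> W"
      using group_filter_base_inv[OF fb W(1)] by blast
    obtain A where A: "openin ?T A" "a \<in> A" "\<And>h. h \<in> A \<Longrightarrow> \<exists>z\<in>Z. h = a \<otimes> z"
      using filter_topology_translate[OF fb Z(1) aG] by metis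
    have "inv x \<in> U" if xA: "x \<in> A" for x
    proof -
      obtain z where z: "z \<in> Z" "x = a \<otimes> z" using A(3)[OF xA] by blast
      have "z \<in> carrier G" using z car Z(1) by blast
      then have "inv x = inv a \<otimes> (a \<otimes> inv z \<otimes> inv a)"
        using aG by (simp add: z(2) inv_mult_group m_assoc inv_mult_cancel)
      moreover have "a \<otimes> inv z \<otimes> inv a \<in> V" using W(2) Z(2) z(1) by blast
      ultimately show ?thesis using V(2) by metis
    qed
    then show "\<exists>V. openin ?T V \<and> a \<in> V \<and> (\<forall>y\<in>V. inv y \<in> U)" using A(1,2) by blast
  next
    show "(\<lambda>x. inv x) \<in> topspace ?T \<rightarrow> topspace ?T"
      by (simp add: top Pi_iff)
  qed
  show "Hausdorff_space ?T"
    unfolding Hausdorff_space_def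
  proof (intro allI impI)
    fix x y assume "x \<in> topspace ?T \<and> y \<in> topspace ?T \<and> x \<noteq> y"
    then have xy: "x \<in> carrier G" "y \<in> carrier G" and "x \<noteq> y"
      using top by auto
    then have "inv x \<otimes> y \<noteq> \<one>"
      using inv_mult_cancel(2)[OF xy] by auto
    \<comment> \<open>A common point \<open>x \<otimes> w = y \<otimes> z\<close> of the two
      translates chosen below would give \<open>inv x \<otimes> y = w \<otimes> inv z\<close>, an
      element of \<open>V\<close>.\<close>
    then obtain V where V: "V \<in> \<F>" "inv x \<otimes> y \<notin> V" using sep by blast
    obtain W where W: "W \<in> \<F>" "\<forall>v\<in>W. \<forall>w\<in>W. v \<otimes> w \<in> V"
      using group_filter_base_mult[OF fb V(1)] by blast
    obtain Z where Z: "Z \<in> \<F>" "\<forall>z\<in>Z. inv z \<in> W"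
      using group_filter_base_inv[OF fb W(1)] by blast
    obtain A where A: "openin ?T A" "x \<in> A" "\<And>h. h \<in> A \<Longrightarrow> \<exists>w\<in>W. h = x \<otimes> w"
      using filter_topology_translate[OF fb W(1) xy(1)] by metis
    obtain B where B: "openin ?T B" "y \<in> B" "\<And>h. h \<in> B \<Longrightarrow> \<exists>z\<in>Z. h = y \<otimes> z"
      using filter_topology_translate[OF fb Z(1) xy(2)] by metis
    have False if hA: "h \<in> A" and hB: "h \<in> B" for h
    proof -
      obtain w z where wz: "w \<in> W" "z \<in> Z" "h = x \<otimes> w" "x \<otimes> w = y \<otimes> z"
        using A(3)[OF hA] B(3)[OF hB] by metis
      have c: "w \<in> carrier G" "z \<in> carrier G" using wz car W(1) Z(1) by blast+
      have "y = x \<otimes> w \<otimes> inv z" using wz(4) c xy by (simp add: m_assoc)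
      then have "inv x \<otimes> y = w \<otimes> inv z" using c xy by (simp add: m_assoc inv_mult_cancel)
      moreover have "w \<otimes> inv z \<in> V" using W(2) Z(2) wz(1,2) by blast
      ultimately show False using V(2) by metis
    qed
    then show "\<exists>U V. openin ?T U \<and> openin ?T V \<and> x \<in> U \<and> y \<in> V \<and> disjnt U V"
      using A(1,2) B(1,2) unfolding disjnt_iff by blast
  qed
qed

end


context group
begin

lemma openin_filter_topology_base:
  assumes "group_filter_base \<F>" "V \<in> \<F>"
  obtains U where "openin (filter_topology \<F>) U" "\<one> \<in> U" "U \<subseteq> V"
proof -
  obtain U where U: "openin (filter_topology \<F>) U" "\<one> \<in> U" "\<And>h. h \<in> U \<Longrightarrow> \<exists>v\<in>V. h = \<one> \<otimes> v"
    using filter_topology_translate[OF assms one_closed] by metis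
  have "U \<subseteq> V"
  proof
    fix h assume "h \<in> U"
    then obtain v where "v \<in> V" "h = \<one> \<otimes> v" using U(3) by blast
    then show "h \<in> V" using group_filter_base_carrier[OF assms] by auto
  qed
  then show ?thesis using U that by blast
qed

lemma continuous_map_filter_topology:
  assumes fb: "group_filter_base \<F>"
    and f: "\<And>x. x \<in> topspace X \<Longrightarrow> f x \<in> carrier G"
    and nhd: "\<And>V x. \<lbrakk>V \<in> \<F>; x \<in> topspace X\<rbrakk>
                \<Longrightarrow> \<exists>U. openin X U \<and> x \<in> U \<and> (\<forall>y\<in>U. inv f x \<otimes> f y \<in> V)"
  shows "continuous_map X (filter_topology \<F>) f"
proof (rule continuous_map_pointwise)
  fix x U assume x: "x \<in> topspace X" and U: "openin (filter_topology \<F>) U" "f x \<in> U"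
  obtain V where V: "V \<in> \<F>" "\<forall>v\<in>V. f x \<otimes> v \<in> U"
    using U openin_filter_topology[OF fb] by blast
  obtain O' where O: "openin X O'" "x \<in> O'" "\<forall>y\<in>O'. inv f x \<otimes> f y \<in> V"
    using nhd[OF V(1) x] by blast
  have "f y \<in> U" if "y \<in> O'" for y
  proof -
    have "y \<in> topspace X" using O(1) that openin_subset by blast
    then have "f x \<otimes> (inv f x \<otimes> f y) = f y"
      using x by (intro inv_mult_cancel f)
    then show ?thesis using O(3) V(2) that by metis
  qed
  then show "\<exists>V. openin X V \<and> x \<in> V \<and> (\<forall>y\<in>V. f y \<in> U)" using O by blast
next
  show "f \<in> topspace X \<rightarrow> topspace (filter_topology \<F>)"
    using f by (simp add: topspace_filter_topology[OF fb] Pi_iff)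
qed

end

section \<open>Uniform neighbourhoods in a topological group\<close>

lemma continuous_map_prod_nhds:
  assumes "continuous_map (prod_topology X Y) Z f" "openin Z N" "x \<in> topspace X" "y \<in> topspace Y"
    "f (x, y) \<in> N"
  obtains U V where "openin X U" "x \<in> U" "openin Y V" "y \<in> V"
    "\<And>u v. \<lbrakk>u \<in> U; v \<in> V\<rbrakk> \<Longrightarrow> f (u, v) \<in> N"
proof -
  let ?W = "{p \<in> topspace (prod_topology X Y). f p \<in> N}"
  have "openin (prod_topology X Y) ?W"
    using assms(1,2) by (rule openin_continuous_map_preimage)
  moreover have "(x, y) \<in> ?W" using assms by simp
  ultimately obtain U V where "openin X U" "openin Y V" "x \<in> U" "y \<in> V" "U \<times> V \<subseteq> ?W"
    unfolding openin_prod_topology_alt by meson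
  then show ?thesis by (intro that[of U V]) blast+
qed

context topological_group
begin

lemma continuous_map_mult:
  assumes "continuous_map Y T f" "continuous_map Y T g"
  shows "continuous_map Y T (\<lambda>x. f x \<otimes> g x)"
  using continuous_map_compose[OF continuous_map_pairedI[OF assms] continuous_mult]
  by (simp add: o_def)

lemma continuous_map_inv:
  assumes "continuous_map Y T f"
  shows "continuous_map Y T (\<lambda>x. inv f x)"
  using continuous_map_compose[OF assms continuous_inv] by (simp add: o_def)

lemma continuous_map_pow: "continuous_map T T (\<lambda>x. x [^] (n::nat))"
proof (induction n)
  case 0
  have "continuous_map T T (\<lambda>x. \<one>)" using topspace_eq by simp
  then show ?case by simp
next
  case (Suc n)
  then show ?case using continuous_map_mult[OF Suc continuous_map_id[unfolded id_def]] by simp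
qed

lemma product_of_two_nhds:
  assumes "openin T N" "\<one> \<in> N"
  obtains M where "openin T M" "\<one> \<in> M" "\<And>x y. \<lbrakk>x \<in> M; y \<in> M\<rbrakk> \<Longrightarrow> x \<otimes> y \<in> N"
proof -
  obtain U V where UV: "openin T U" "\<one> \<in> U" "openin T V" "\<one> \<in> V"
    "\<And>x y. \<lbrakk>x \<in> U; y \<in> V\<rbrakk> \<Longrightarrow> (\<lambda>(x, y). x \<otimes> y) (x, y) \<in> N"
    by (rule continuous_map_prod_nhds[OF continuous_mult assms(1), of \<one> \<one>])
      (use assms topspace_eq in auto)
  show ?thesis
    by (rule that[of "U \<inter> V"]) (use UV in auto)
qed

text \<open>Three factors, because \<open>hom_basic_nhd\<close> cuts a product at its factor of
  least index into a left part, that factor and a right part.\<close>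

lemma product_of_three_nhds:
  assumes "openin T N" "\<one> \<in> N"
  obtains M where "openin T M" "\<one> \<in> M" "M \<subseteq> N"
    "\<And>x y z. \<lbrakk>x \<in> M; y \<in> M; z \<in> M\<rbrakk> \<Longrightarrow> x \<otimes> (y \<otimes> z) \<in> N"
proof -
  obtain M where M: "openin T M" "\<one> \<in> M" "\<And>x y. \<lbrakk>x \<in> M; y \<in> M\<rbrakk> \<Longrightarrow> x \<otimes> y \<in> N"
    by (rule product_of_two_nhds[OF assms]) blast
  obtain L where L: "openin T L" "\<one> \<in> L" "\<And>x y. \<lbrakk>x \<in> L; y \<in> L\<rbrakk> \<Longrightarrow> x \<otimes> y \<in> M"
    by (rule product_of_two_nhds[OF M(1,2)]) blast
  \<comment> \<open>Taking the second factor to be \<open>\<one>\<close> shows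
    \<open>M \<subseteq> N\<close>.\<close>
  have "x \<in> N" if "x \<in> M" for x
    using M(3)[OF that M(2)] M(1) that topspace_eq openin_subset by fastforce
  then show ?thesis
    using L M by (intro that[of "L \<inter> M"]) auto
qed

text \<open>By the tube lemma: the conjugate is continuous in \<open>(z, m)\<close> and trivial at
  \<open>m = \<one>\<close>, so compactness yields one neighbourhood that serves all conjugators
  \<open>k z\<close> at once.\<close>

lemma conjugation_nhds_compact:
  assumes X: "compact_space X" and k: "continuous_map X T k" and N: "openin T N" "\<one> \<in> N"
  obtains M where "openin T M" "\<one> \<in> M"
    "\<And>z m. \<lbrakk>z \<in> topspace X; m \<in> M\<rbrakk> \<Longrightarrow> k z \<otimes> m \<otimes> inv k z \<in> N"
proof -
  let ?f = "\<lambda>p. k (fst p) \<otimes> snd p \<otimes> inv k (fst p)"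
  have "continuous_map (prod_topology X T) T (\<lambda>p. k (fst p))"
    using continuous_map_compose[OF continuous_map_fst k] by (simp add: o_def)
  then have "continuous_map (prod_topology X T) T ?f"
    by (intro continuous_map_mult continuous_map_inv continuous_map_snd)
  then have W: "openin (prod_topology X T) {p \<in> topspace (prod_topology X T). ?f p \<in> N}"
    using N(1) by (rule openin_continuous_map_preimage)
  have "k z \<in> carrier G" if "z \<in> topspace X" for z
    using continuous_map_image_subset_topspace[OF k] that topspace_eq by blast
  then have sub: "topspace X \<times> {\<one>} \<subseteq> {p \<in> topspace (prod_topology X T). ?f p \<in> N}"
    using N(2) topspace_eq by auto
  have "compactin X (topspace X)" "\<one> \<in> topspace T"
    using X topspace_eq by (simp_all add: compact_space_def)
  from tube_lemma_left[OF W this sub]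
  obtain U V where V: "openin T V" "\<one> \<in> V" and U: "topspace X \<subseteq> U"
    and UV: "U \<times> V \<subseteq> {p \<in> topspace (prod_topology X T). ?f p \<in> N}"
    by blast
  have "?f (z, m) \<in> N" if "z \<in> topspace X" "m \<in> V" for z m
    using UV U that by blast
  then show ?thesis using V that by simp
qed

end


section \<open>Neighbourhoods built from sequences of entourages\<close>

text \<open>Neighbourhoods of the diagonal. On a compact Hausdorff space, cut down to pairs of its
  points, they are the entourages of the unique compatible uniformity. Pairs outside the space are
  allowed, so that \<open>UNIV\<close> qualifies.\<close>

definition entourage :: "'a topology \<Rightarrow> ('a \<times> 'a) set \<Rightarrow> bool" where
  "entourage X E \<longleftrightarrow> (\<forall>x\<in>topspace X. \<exists>U. openin X U \<and> x \<in> U \<and> U \<times> U \<subseteq> E)"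

lemma entourage_Int:
  assumes "entourage X E" "entourage X F"
  shows "entourage X (E \<inter> F)"
  unfolding entourage_def
proof
  fix x assume "x \<in> topspace X"
  then obtain U V where "openin X U" "x \<in> U" "U \<times> U \<subseteq> E" "openin X V" "x \<in> V" "V \<times> V \<subseteq> F"
    using assms unfolding entourage_def by meson
  then show "\<exists>U. openin X U \<and> x \<in> U \<and> U \<times> U \<subseteq> E \<inter> F"
    by (intro exI[of _ "U \<inter> V"]) auto
qed

lemma entourage_converse: "entourage X E \<Longrightarrow> entourage X (E\<inverse>)"
  unfolding entourage_def by fast

lemma entourage_mono: "entourage X E \<Longrightarrow> E \<subseteq> F \<Longrightarrow> entourage X F"
  unfolding entourage_def by (meson subset_trans)

lemma entourage_UNIV: "entourage X UNIV"
  unfolding entourage_def using openin_topspace subset_UNIV by metis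

lemma (in topological_group) entourage_left_quotient:
  assumes k: "continuous_map X T k" and N: "openin T N" "\<one> \<in> N"
  shows "entourage X {(x, y). inv k x \<otimes> k y \<in> N}"
  unfolding entourage_def
proof
  fix x assume x: "x \<in> topspace X"
  have kx: "k x \<in> carrier G"
    using continuous_map_image_subset_topspace[OF k] x topspace_eq by blast
  have f: "continuous_map (prod_topology X X) T (\<lambda>p. inv k (fst p) \<otimes> k (snd p))"
    using continuous_map_compose[OF continuous_map_fst k] continuous_map_compose[OF continuous_map_snd k]
    by (intro continuous_map_mult continuous_map_inv) (simp_all add: o_def)
  obtain U V where "openin X U" "x \<in> U" "openin X V" "x \<in> V"
    "\<And>u v. \<lbrakk>u \<in> U; v \<in> V\<rbrakk> \<Longrightarrow> inv k (fst (u, v)) \<otimes> k (snd (u, v)) \<in> N"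
    by (rule continuous_map_prod_nhds[OF f N(1) x x]) (use N kx in auto)
  then show "\<exists>U. openin X U \<and> x \<in> U \<and> U \<times> U \<subseteq> {(x, y). inv k x \<otimes> k y \<in> N}"
    by (intro exI[of _ "U \<inter> V"]) auto
qed

text \<open>Common setting for the free and the free Abelian group. No topology on \<open>G\<close>
  is fixed; one is built below from the entourages of \<open>X\<close>.\<close>

locale compactly_generated_group = group G for G :: "('g, 'm) monoid_scheme" (structure) +
  fixes X :: "'a topology" and \<iota> :: "'a \<Rightarrow> 'g"
  assumes compact: "compact_space X"
    and gen_closed: "\<And>x. x \<in> topspace X \<Longrightarrow> \<iota> x \<in> carrier G"
    and generated: "carrier G \<subseteq> generate G (\<iota> ` topspace X)"
begin

text \<open>The length bound is what lets compactness act: conjugators from \<open>words n\<close>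
  are treated one letter at a time, so that a single entourage serves all of them.\<close>

primrec words :: "nat \<Rightarrow> 'g set" where
  "words 0 = {\<one>}"
| "words (Suc n) = words n \<union> {\<iota> z \<otimes> g | z g. z \<in> topspace X \<and> g \<in> words n}
                            \<union> {inv \<iota> z \<otimes> g | z g. z \<in> topspace X \<and> g \<in> words n}"

lemma words_closed: "g \<in> words n \<Longrightarrow> g \<in> carrier G"
  by (induction n arbitrary: g) (auto simp: gen_closed)

lemma words_mono: "m \<le> n \<Longrightarrow> words m \<subseteq> words n"
  by (rule lift_Suc_mono_le[of words]) auto

lemma words_mult: "g \<in> words m \<Longrightarrow> h \<in> words n \<Longrightarrow> g \<otimes> h \<in> words (m + n)"
proof (induction m arbitrary: g)
  case 0
  then show ?case by (simp add: words_closed)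
next
  case (Suc m)
  note h = words_closed[OF Suc.prems(2)]
  consider "g \<in> words m" | z g' where "z \<in> topspace X" "g' \<in> words m" "g = \<iota> z \<otimes> g'"
    | z g' where "z \<in> topspace X" "g' \<in> words m" "g = inv \<iota> z \<otimes> g'"
    using Suc.prems(1) by auto
  then show ?case
  proof cases
    case 1
    then show ?thesis using Suc by simp
  next
    case 2
    then have "g \<otimes> h = \<iota> z \<otimes> (g' \<otimes> h)"
      using h gen_closed words_closed by (simp add: m_assoc)
    moreover have "g' \<otimes> h \<in> words (m + n)" using Suc 2 by simp
    ultimately show ?thesis using 2(1) by auto
  next
    case 3
    then have "g \<otimes> h = inv \<iota> z \<otimes> (g' \<otimes> h)"
      using h gen_closed words_closed by (simp add: m_assoc)
    moreover have "g' \<otimes> h \<in> words (m + n)" using Suc 3 by simp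
    ultimately show ?thesis using 3(1) by auto
  qed
qed

lemma in_words:
  assumes "g \<in> carrier G"
  obtains n where "g \<in> words n"
proof -
  have "g \<in> generate G (\<iota> ` topspace X)" using assms generated by blast
  then have "\<exists>n. g \<in> words n"
  proof induction
    case one
    show ?case by (intro exI[of _ 0]) simp
  next
    case (incl h)
    then obtain z where z: "z \<in> topspace X" "h = \<iota> z" by blast
    then have "h = \<iota> z \<otimes> \<one>" using gen_closed by simp
    then have "h \<in> words (Suc 0)" using z by auto
    then show ?case by blast
  next
    case (inv h)
    then obtain z where z: "z \<in> topspace X" "h = \<iota> z" by blast
    then have "inv h = inv \<iota> z \<otimes> \<one>" using gen_closed by simp
    then have "inv h \<in> words (Suc 0)" using z by auto
    then show ?case by blast
  next
    case (eng g h)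
    then show ?case using words_mult by blast
  qed
  then show ?thesis using that by blast
qed

definition conjs :: "nat \<Rightarrow> ('a \<times> 'a) set \<Rightarrow> 'g set" where
  "conjs n E = {g \<otimes> (inv \<iota> x \<otimes> \<iota> y) \<otimes> inv g | g x y.
                  g \<in> words n \<and> x \<in> topspace X \<and> y \<in> topspace X \<and> (x, y) \<in> E}"

lemma conjsI:
  assumes "g \<in> words n" "x \<in> topspace X" "y \<in> topspace X" "(x, y) \<in> E"
  shows "g \<otimes> (inv \<iota> x \<otimes> \<iota> y) \<otimes> inv g \<in> conjs n E"
  using assms unfolding conjs_def by blast

lemma conjsE:
  assumes "h \<in> conjs n E"
  obtains g x y where "h = g \<otimes> (inv \<iota> x \<otimes> \<iota> y) \<otimes> inv g" "g \<in> words n"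
    "x \<in> topspace X" "y \<in> topspace X" "(x, y) \<in> E"
  using assms unfolding conjs_def by blast

lemma conjs_closed: "h \<in> conjs n E \<Longrightarrow> h \<in> carrier G"
  by (auto simp: conjs_def words_closed gen_closed)

lemma conjs_mono: "m \<le> n \<Longrightarrow> E \<subseteq> F \<Longrightarrow> conjs m E \<subseteq> conjs n F"
  using words_mono unfolding conjs_def by blast

lemma conjs_conj:
  assumes "g \<in> words m" "h \<in> conjs n E"
  shows "g \<otimes> h \<otimes> inv g \<in> conjs (m + n) E"
  using assms(2)
proof (rule conjsE)
  fix k x y assume h: "h = k \<otimes> (inv \<iota> x \<otimes> \<iota> y) \<otimes> inv k" and k: "k \<in> words n"
    and xy: "x \<in> topspace X" "y \<in> topspace X" "(x, y) \<in> E"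
  have "g \<otimes> h \<otimes> inv g = (g \<otimes> k) \<otimes> (inv \<iota> x \<otimes> \<iota> y) \<otimes> inv (g \<otimes> k)"
    using words_closed[OF k] words_closed[OF assms(1)] gen_closed xy
    by (simp add: h m_assoc inv_mult_group)
  then show ?thesis
    using conjsI[OF words_mult[OF assms(1) k] xy] by simp
qed

lemma conjs_inv:
  assumes "h \<in> conjs n (E\<inverse>)"
  shows "inv h \<in> conjs n E"
  using assms
proof (rule conjsE)
  fix k x y assume h: "h = k \<otimes> (inv \<iota> x \<otimes> \<iota> y) \<otimes> inv k" and k: "k \<in> words n"
    and xy: "x \<in> topspace X" "y \<in> topspace X" "(x, y) \<in> E\<inverse>"
  have "inv h = k \<otimes> (inv \<iota> y \<otimes> \<iota> x) \<otimes> inv k"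
    using words_closed[OF k] gen_closed xy by (simp add: h m_assoc inv_mult_group)
  then show ?thesis
    using conjsI[OF k xy(2,1)] xy(3) by simp
qed

section \<open>Ordered products and the basic neighbourhoods\<close>

definition list_prod :: "(nat \<Rightarrow> 'g) \<Rightarrow> nat list \<Rightarrow> 'g" where
  "list_prod a ns = foldr (\<lambda>n z. a n \<otimes> z) ns \<one>"

lemma list_prod_simps [simp]:
  "list_prod a [] = \<one>" "list_prod a (n # ns) = a n \<otimes> list_prod a ns"
  by (simp_all add: list_prod_def)

lemma list_prod_closed: "(\<And>n. n \<in> set ns \<Longrightarrow> a n \<in> carrier G) \<Longrightarrow> list_prod a ns \<in> carrier G"
  by (induction ns) auto

lemma list_prod_append:
  assumes "\<And>n. n \<in> set ns \<union> set ms \<Longrightarrow> a n \<in> carrier G"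
  shows "list_prod a (ns @ ms) = list_prod a ns \<otimes> list_prod a ms"
  using assms
proof (induction ns)
  case Nil
  then show ?case using list_prod_closed[of ms a] by simp
next
  case (Cons n ns)
  then have "a n \<in> carrier G" "list_prod a ns \<in> carrier G" "list_prod a ms \<in> carrier G"
    by (auto intro: list_prod_closed)
  then show ?case using Cons by (simp add: m_assoc)
qed

lemma list_prod_map: "list_prod a (map f ns) = list_prod (\<lambda>n. a (f n)) ns"
  by (induction ns) auto

lemma list_prod_conj:
  assumes "g \<in> carrier G" "\<And>n. n \<in> set ns \<Longrightarrow> a n \<in> carrier G"
  shows "g \<otimes> list_prod a ns \<otimes> inv g = list_prod (\<lambda>n. g \<otimes> a n \<otimes> inv g) ns"
  using assms(2)
proof (induction ns)
  case Nil
  then show ?case using assms(1) by simp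
next
  case (Cons n ns)
  then have c: "a n \<in> carrier G" "list_prod a ns \<in> carrier G" by (auto intro: list_prod_closed)
  have "g \<otimes> list_prod a (n # ns) \<otimes> inv g = (g \<otimes> a n \<otimes> inv g) \<otimes> (g \<otimes> list_prod a ns \<otimes> inv g)"
    using c assms(1) by (simp add: m_assoc inv_mult_cancel)
  then show ?case using Cons by simp
qed

lemma list_prod_inv:
  assumes "\<And>n. n \<in> set ns \<Longrightarrow> a n \<in> carrier G"
  shows "inv list_prod a ns = list_prod (\<lambda>n. inv a n) (rev ns)"
  using assms
proof (induction ns)
  case (Cons n ns)
  then have "a n \<in> carrier G" "list_prod a ns \<in> carrier G" by (auto intro: list_prod_closed)
  moreover have "list_prod (\<lambda>n. inv a n) (rev ns @ [n]) =
      list_prod (\<lambda>n. inv a n) (rev ns) \<otimes> list_prod (\<lambda>n. inv a n) [n]"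
    using Cons.prems by (intro list_prod_append) auto
  ultimately show ?case using Cons by (simp add: inv_mult_group)
qed simp

text \<open>Indices may come in any order, so that products are obtained by concatenating lists and
  inverses by reversing them. Distinctness means that each entourage is spent at most once.\<close>

definition basic_nhd :: "(nat \<Rightarrow> ('a \<times> 'a) set) \<Rightarrow> 'g set" where
  "basic_nhd U = {list_prod a ns | a ns. distinct ns \<and> (\<forall>n\<in>set ns. a n \<in> conjs n (U n))}"

lemma basic_nhdI:
  "distinct ns \<Longrightarrow> (\<And>n. n \<in> set ns \<Longrightarrow> a n \<in> conjs n (U n)) \<Longrightarrow> list_prod a ns \<in> basic_nhd U"
  unfolding basic_nhd_def by blast

lemma basic_nhdE:
  assumes "g \<in> basic_nhd U"
  obtains a ns where "g = list_prod a ns" "distinct ns" "\<And>n. n \<in> set ns \<Longrightarrow> a n \<in> conjs n (U n)"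
    "\<And>n. n \<in> set ns \<Longrightarrow> a n \<in> carrier G"
  using assms conjs_closed unfolding basic_nhd_def by blast

lemma basic_nhd_mono: "(\<And>n. U n \<subseteq> V n) \<Longrightarrow> basic_nhd U \<subseteq> basic_nhd V"
  using conjs_mono[OF order_refl] unfolding basic_nhd_def by blast

lemma basic_nhd_closed: "basic_nhd U \<subseteq> carrier G"
  by (auto elim!: basic_nhdE intro: list_prod_closed)

lemma one_in_basic_nhd: "\<one> \<in> basic_nhd U"
  using basic_nhdI[of "[]"] by simp

text \<open>The factors of \<open>v\<close> are moved to the even indices and those of
  \<open>w\<close> to the odd ones, which keeps the concatenated list distinct. Indices only grow,
  so the bounds on the conjugators remain valid.\<close>

lemma basic_nhd_mult:
  assumes "v \<in> basic_nhd (\<lambda>n. U (2 * n) \<inter> U (Suc (2 * n)))"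
    and "w \<in> basic_nhd (\<lambda>n. U (2 * n) \<inter> U (Suc (2 * n)))"
  shows "v \<otimes> w \<in> basic_nhd U"
  using assms(1)
proof (rule basic_nhdE)
  fix a ns assume v: "v = list_prod a ns" "distinct ns"
    "\<And>n. n \<in> set ns \<Longrightarrow> a n \<in> conjs n (U (2 * n) \<inter> U (Suc (2 * n)))"
  show ?thesis
    using assms(2)
  proof (rule basic_nhdE)
    fix b ms assume w: "w = list_prod b ms" "distinct ms"
      "\<And>n. n \<in> set ms \<Longrightarrow> b n \<in> conjs n (U (2 * n) \<inter> U (Suc (2 * n)))"
    define c where "c k = (if even k then a (k div 2) else b (k div 2))" for k
    let ?ks = "map (\<lambda>n. 2 * n) ns @ map (\<lambda>n. Suc (2 * n)) ms"
    have c: "c k \<in> conjs k (U k)" if k: "k \<in> set ?ks" for k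
    proof -
      consider n where "n \<in> set ns" "k = 2 * n" | n where "n \<in> set ms" "k = Suc (2 * n)"
        using k by auto
      then show ?thesis
      proof cases
        case 1
        then show ?thesis
          using v(3)[of n] conjs_mono[of n k "U k \<inter> U (Suc k)" "U k"] by (auto simp: c_def)
      next
        case 2
        then show ?thesis
          using w(3)[of n] conjs_mono[of n k "U (2 * n) \<inter> U k" "U k"] by (auto simp: c_def)
      qed
    qed
    have "distinct ?ks"
      using v(2) w(2) by (auto simp: distinct_map inj_on_def) presburger
    then have "list_prod c ?ks \<in> basic_nhd U"
      using c by (rule basic_nhdI)
    moreover have "list_prod c ?ks = v \<otimes> w"
    proof -
      have "list_prod c ?ks = list_prod c (map (\<lambda>n. 2 * n) ns) \<otimes> list_prod c (map (\<lambda>n. Suc (2 * n)) ms)"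
        using c conjs_closed by (intro list_prod_append) auto
      then show ?thesis unfolding list_prod_map v w by (simp add: c_def)
    qed
    ultimately show ?thesis by simp
  qed
qed

text \<open>Conjugation distributes over the factors and lengthens each conjugator by at most
  \<open>m\<close>; shifting the indices by \<open>m\<close> makes room for this.\<close>

lemma basic_nhd_conj:
  assumes g: "g \<in> words m" and v: "v \<in> basic_nhd (\<lambda>n. U (m + n))"
  shows "g \<otimes> v \<otimes> inv g \<in> basic_nhd U"
  using v
proof (rule basic_nhdE)
  fix a ns assume a: "v = list_prod a ns" "distinct ns"
    "\<And>n. n \<in> set ns \<Longrightarrow> a n \<in> conjs n (U (m + n))" "\<And>n. n \<in> set ns \<Longrightarrow> a n \<in> carrier G"
  define c where "c k = g \<otimes> a (k - m) \<otimes> inv g" for k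
  have "list_prod c (map (\<lambda>n. m + n) ns) \<in> basic_nhd U"
  proof (rule basic_nhdI)
    fix k assume "k \<in> set (map (\<lambda>n. m + n) ns)"
    then show "c k \<in> conjs k (U k)"
      using conjs_conj[OF g] a(3) by (auto simp: c_def)
  qed (use a(2) in \<open>simp add: distinct_map\<close>)
  then show ?thesis
    by (simp add: list_prod_map c_def a(1) list_prod_conj[OF words_closed[OF g] a(4)])
qed

text \<open>Inverting a factor exchanges \<open>x\<close> and \<open>y\<close> and keeps the
  conjugator, hence the converse entourages; the order of the factors is reversed.\<close>

lemma basic_nhd_inv:
  assumes "v \<in> basic_nhd (\<lambda>n. (U n)\<inverse>)"
  shows "inv v \<in> basic_nhd U"
  using assms
proof (rule basic_nhdE)
  fix a ns assume a: "v = list_prod a ns" "distinct ns"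
    "\<And>n. n \<in> set ns \<Longrightarrow> a n \<in> conjs n ((U n)\<inverse>)" "\<And>n. n \<in> set ns \<Longrightarrow> a n \<in> carrier G"
  have "list_prod (\<lambda>n. inv a n) (rev ns) \<in> basic_nhd U"
    using a conjs_inv by (intro basic_nhdI) auto
  then show ?thesis using list_prod_inv[OF a(4)] a(1) by simp
qed

definition basic_nhds :: "'g set set" where
  "basic_nhds = {basic_nhd U | U. \<forall>n. entourage X (U n)}"

lemma basic_nhdsI: "(\<And>n. entourage X (U n)) \<Longrightarrow> basic_nhd U \<in> basic_nhds"
  unfolding basic_nhds_def by blast

lemma basic_nhdsE:
  assumes "V \<in> basic_nhds"
  obtains U where "V = basic_nhd U" "\<forall>n. entourage X (U n)"
  using assms unfolding basic_nhds_def by blast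

lemma group_filter_base_basic_nhds: "group_filter_base basic_nhds"
  unfolding group_filter_base_def
proof (intro conjI ballI)
  show "basic_nhds \<noteq> {}" using basic_nhdsI[OF entourage_UNIV] by blast
next
  fix V assume "V \<in> basic_nhds"
  then obtain U where U: "V = basic_nhd U" "\<forall>n. entourage X (U n)"
    by (rule basic_nhdsE)
  show "\<one> \<in> V" "V \<subseteq> carrier G"
    using one_in_basic_nhd basic_nhd_closed U(1) by simp_all
  have "basic_nhd (\<lambda>n. U (2 * n) \<inter> U (Suc (2 * n))) \<in> basic_nhds"
    by (intro basic_nhdsI entourage_Int U(2)[rule_format])
  then show "\<exists>W\<in>basic_nhds. \<forall>v\<in>W. \<forall>w\<in>W. v \<otimes> w \<in> V"
    using basic_nhd_mult U(1) by blast
  have "basic_nhd (\<lambda>n. (U n)\<inverse>) \<in> basic_nhds"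
    by (intro basic_nhdsI entourage_converse U(2)[rule_format])
  then show "\<exists>W\<in>basic_nhds. \<forall>w\<in>W. inv w \<in> V"
    using basic_nhd_inv U(1) by blast
  {
    fix W assume "W \<in> basic_nhds"
    then obtain U' where U': "W = basic_nhd U'" "\<forall>n. entourage X (U' n)"
      by (rule basic_nhdsE)
    have "basic_nhd (\<lambda>n. U n \<inter> U' n) \<in> basic_nhds"
      by (intro basic_nhdsI entourage_Int U(2)[rule_format] U'(2)[rule_format])
    moreover have "basic_nhd (\<lambda>n. U n \<inter> U' n) \<subseteq> V \<inter> W"
      unfolding U(1) U'(1) by (intro Int_greatest basic_nhd_mono) auto
    ultimately show "\<exists>Z\<in>basic_nhds. Z \<subseteq> V \<inter> W" by blast
  }
  {
    fix g assume "g \<in> carrier G"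
    then obtain m where m: "g \<in> words m" by (rule in_words)
    have "basic_nhd (\<lambda>n. U (m + n)) \<in> basic_nhds"
      by (intro basic_nhdsI U(2)[rule_format])
    then show "\<exists>W\<in>basic_nhds. \<forall>w\<in>W. g \<otimes> w \<otimes> inv g \<in> V"
      using basic_nhd_conj[OF m] U(1) by blast
  }
qed

lemma continuous_map_basic_nhds: "continuous_map X (filter_topology basic_nhds) \<iota>"
proof (rule continuous_map_filter_topology[OF group_filter_base_basic_nhds gen_closed])
  fix V x assume V: "V \<in> basic_nhds" and x: "x \<in> topspace X"
  from V obtain U where U: "V = basic_nhd U" "\<forall>n. entourage X (U n)"
    by (rule basic_nhdsE)
  obtain O' where O: "openin X O'" "x \<in> O'" "O' \<times> O' \<subseteq> U 0"
    using U(2) x unfolding entourage_def by blast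
  have "inv \<iota> x \<otimes> \<iota> y \<in> V" if y: "y \<in> O'" for y
  proof -
    have yX: "y \<in> topspace X" using O(1) y openin_subset by blast
    \<comment> \<open>One factor suffices: index 0, with the empty word as conjugator.\<close>
    have "\<one> \<otimes> (inv \<iota> x \<otimes> \<iota> y) \<otimes> inv \<one> \<in> conjs 0 (U 0)"
      using x yX O y by (intro conjsI) auto
    then have "list_prod (\<lambda>n. inv \<iota> x \<otimes> \<iota> y) [0] \<in> V"
      unfolding U(1) using x yX gen_closed by (intro basic_nhdI) auto
    then show ?thesis using x yX gen_closed by simp
  qed
  then show "\<exists>U. openin X U \<and> x \<in> U \<and> (\<forall>y\<in>U. inv \<iota> x \<otimes> \<iota> y \<in> V)" using O by blast
qed

text \<open>Induction on the length of the conjugator, peeling off its outermost letter. Compactness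
  of \<open>X\<close> makes the neighbourhood independent of that letter.\<close>

lemma hom_conjs_nhd:
  assumes H: "topological_group H T" and \<Phi>: "\<Phi> \<in> hom G H"
    and cont: "continuous_map X T (\<lambda>x. \<Phi> (\<iota> x))"
    and N: "openin T N" "\<one>\<^bsub>H\<^esub> \<in> N"
  shows "\<exists>E. entourage X E \<and> (\<forall>h\<in>conjs n E. \<Phi> h \<in> N)"
  using N
proof (induction n arbitrary: N)
  interpret H: topological_group H T by (rule H)
  interpret \<Phi>: group_hom G H \<Phi> using \<Phi> by unfold_locales
  {
    case 0
    let ?E = "{(x, y). inv\<^bsub>H\<^esub> \<Phi> (\<iota> x) \<otimes>\<^bsub>H\<^esub> \<Phi> (\<iota> y) \<in> N}"
    have "\<Phi> h \<in> N" if "h \<in> conjs 0 ?E" for h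
      using that by (rule conjsE) (simp add: gen_closed)
    then show ?case
      using H.entourage_left_quotient[OF cont 0] by blast
  next
    case (Suc n)
    obtain M1 where M1: "openin T M1" "\<one>\<^bsub>H\<^esub> \<in> M1"
      "\<And>z m. \<lbrakk>z \<in> topspace X; m \<in> M1\<rbrakk> \<Longrightarrow> \<Phi> (\<iota> z) \<otimes>\<^bsub>H\<^esub> m \<otimes>\<^bsub>H\<^esub> inv\<^bsub>H\<^esub> \<Phi> (\<iota> z) \<in> N"
      by (rule H.conjugation_nhds_compact[OF compact cont Suc.prems]) blast
    obtain M2 where M2: "openin T M2" "\<one>\<^bsub>H\<^esub> \<in> M2"
      "\<And>z m. \<lbrakk>z \<in> topspace X; m \<in> M2\<rbrakk>
          \<Longrightarrow> inv\<^bsub>H\<^esub> \<Phi> (\<iota> z) \<otimes>\<^bsub>H\<^esub> m \<otimes>\<^bsub>H\<^esub> inv\<^bsub>H\<^esub> (inv\<^bsub>H\<^esub> \<Phi> (\<iota> z)) \<in> N"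
      by (rule H.conjugation_nhds_compact[OF compact H.continuous_map_inv[OF cont] Suc.prems]) blast
    \<comment> \<open>\<open>N\<close> handles conjugators that already lie in
      \<open>words n\<close>, \<open>M1\<close> those with a generator in front, and
      \<open>M2\<close> those with an inverse generator in front.\<close>
    let ?M = "N \<inter> (M1 \<inter> M2)"
    have "openin T ?M" "\<one>\<^bsub>H\<^esub> \<in> ?M" using M1 M2 Suc.prems by auto
    then obtain E where E: "entourage X E" "\<forall>h\<in>conjs n E. \<Phi> h \<in> ?M"
      using Suc.IH by blast
    have "\<Phi> h \<in> N" if "h \<in> conjs (Suc n) E" for h
      using that
    proof (rule conjsE)
      fix g x y assume h: "h = g \<otimes> (inv \<iota> x \<otimes> \<iota> y) \<otimes> inv g" and g: "g \<in> words (Suc n)"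
        and xy: "x \<in> topspace X" "y \<in> topspace X" "(x, y) \<in> E"
      let ?c = "\<lambda>g. g \<otimes> (inv \<iota> x \<otimes> \<iota> y) \<otimes> inv g"
      have c: "?c g \<in> carrier G" "\<Phi> (?c g) \<in> ?M" if "g \<in> words n" for g
        using conjsI[OF that xy] conjs_closed E(2) by blast+
      have split: "?c (k \<otimes> g) = k \<otimes> ?c g \<otimes> inv k" if "g \<in> words n" "k \<in> carrier G" for g k
        using that words_closed[OF that(1)] gen_closed xy by (simp add: m_assoc inv_mult_group)
      consider "g \<in> words n" | z g' where "z \<in> topspace X" "g' \<in> words n" "g = \<iota> z \<otimes> g'"
        | z g' where "z \<in> topspace X" "g' \<in> words n" "g = inv \<iota> z \<otimes> g'"
        using g by auto
      then show ?thesis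
      proof cases
        case 1
        then show ?thesis using c(2) h by blast
      next
        case 2
        then have "\<Phi> h = \<Phi> (\<iota> z) \<otimes>\<^bsub>H\<^esub> \<Phi> (?c g') \<otimes>\<^bsub>H\<^esub> inv\<^bsub>H\<^esub> \<Phi> (\<iota> z)"
          unfolding h 2(3) using split[OF 2(2), of "\<iota> z"] c(1)[OF 2(2)] gen_closed by simp
        then show ?thesis using M1(3)[OF 2(1)] c(2)[OF 2(2)] by simp
      next
        case 3
        then have "\<Phi> h = inv\<^bsub>H\<^esub> \<Phi> (\<iota> z) \<otimes>\<^bsub>H\<^esub> \<Phi> (?c g') \<otimes>\<^bsub>H\<^esub> inv\<^bsub>H\<^esub> (inv\<^bsub>H\<^esub> \<Phi> (\<iota> z))"
          unfolding h 3(3) using split[OF 3(2), of "inv \<iota> z"] c(1)[OF 3(2)] gen_closed by simp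
        then show ?thesis using M2(3)[OF 3(1)] c(2)[OF 3(2)] by simp
      qed
    qed
    then show ?case using E(1) by blast
  }
qed

text \<open>Applied to the identity, this makes the basic neighbourhoods cofinal; applied to
  homomorphisms into known groups, it separates elements from the identity. The proof takes
  neighbourhoods \<open>M n\<close> in which any product of three elements of
  \<open>M (Suc n)\<close> lies in \<open>M n\<close>.\<close>

lemma hom_basic_nhd:
  assumes H: "topological_group H T" and \<Phi>: "\<Phi> \<in> hom G H"
    and cont: "continuous_map X T (\<lambda>x. \<Phi> (\<iota> x))"
    and N: "openin T N" "\<one>\<^bsub>H\<^esub> \<in> N"
  obtains U where "\<And>n. entourage X (U n)" "\<And>g. g \<in> basic_nhd U \<Longrightarrow> \<Phi> g \<in> N"
proof -
  interpret H: topological_group H T by (rule H)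
  interpret \<Phi>: group_hom G H \<Phi> using \<Phi> by unfold_locales
  have "\<exists>M. \<forall>n. (openin T (M n) \<and> \<one>\<^bsub>H\<^esub> \<in> M n \<and> M n \<subseteq> N) \<and>
      (M (Suc n) \<subseteq> M n \<and> (\<forall>x\<in>M (Suc n). \<forall>y\<in>M (Suc n). \<forall>z\<in>M (Suc n). x \<otimes>\<^bsub>H\<^esub> (y \<otimes>\<^bsub>H\<^esub> z) \<in> M n))"
  proof (rule dependent_nat_choice)
    show "\<exists>M. openin T M \<and> \<one>\<^bsub>H\<^esub> \<in> M \<and> M \<subseteq> N" using N by blast
    fix M assume M: "openin T M \<and> \<one>\<^bsub>H\<^esub> \<in> M \<and> M \<subseteq> N"
    then obtain L where L: "openin T L" "\<one>\<^bsub>H\<^esub> \<in> L" "L \<subseteq> M"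
      "\<And>x y z. \<lbrakk>x \<in> L; y \<in> L; z \<in> L\<rbrakk> \<Longrightarrow> x \<otimes>\<^bsub>H\<^esub> (y \<otimes>\<^bsub>H\<^esub> z) \<in> M"
      using H.product_of_three_nhds[of M] by metis
    then show "\<exists>L. (openin T L \<and> \<one>\<^bsub>H\<^esub> \<in> L \<and> L \<subseteq> N) \<and>
        (L \<subseteq> M \<and> (\<forall>x\<in>L. \<forall>y\<in>L. \<forall>z\<in>L. x \<otimes>\<^bsub>H\<^esub> (y \<otimes>\<^bsub>H\<^esub> z) \<in> M))"
      using M by (intro exI[of _ L]) auto
  qed
  then obtain M where M: "\<And>n. openin T (M n)" "\<And>n. \<one>\<^bsub>H\<^esub> \<in> M n" "\<And>n. M n \<subseteq> N" "\<And>n. M (Suc n) \<subseteq> M n"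
    "\<And>n x y z. \<lbrakk>x \<in> M (Suc n); y \<in> M (Suc n); z \<in> M (Suc n)\<rbrakk> \<Longrightarrow> x \<otimes>\<^bsub>H\<^esub> (y \<otimes>\<^bsub>H\<^esub> z) \<in> M n"
    by metis
  \<comment> \<open>The factor of index \<open>n\<close> is put into \<open>M (Suc n)\<close>, not
    \<open>M n\<close>: when it is the one of least index, it is multiplied with a left and a right
    part that also lie in \<open>M (Suc n)\<close>.\<close>
  have "\<exists>E. entourage X E \<and> (\<forall>h\<in>conjs n E. \<Phi> h \<in> M (Suc n))" for n
    using hom_conjs_nhd[OF H \<Phi> cont M(1,2)] .
  then obtain U where U: "\<And>n. entourage X (U n)" "\<And>n h. h \<in> conjs n (U n) \<Longrightarrow> \<Phi> h \<in> M (Suc n)"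
    by metis
  \<comment> \<open>The factors come in arbitrary order: split the product at the factor of least index.\<close>
  have key: "\<Phi> (list_prod a ns) \<in> M k"
    if "distinct ns" "\<And>n. n \<in> set ns \<Longrightarrow> a n \<in> conjs n (U n) \<and> k \<le> n \<and> n < k + d" for a ns k d
    using that
  proof (induction d arbitrary: k ns)
    case 0
    have False if "n \<in> set ns" for n
      using 0(2)[OF that] by linarith
    then have "ns = []" by (meson last_in_set)
    then show ?case using M(2) by simp
  next
    case (Suc d)
    have a: "a n \<in> carrier G" if "n \<in> set ns" for n
      using Suc.prems(2) that conjs_closed by blast
    show ?case
    proof (cases "k \<in> set ns")
      case False
      have "\<Phi> (list_prod a ns) \<in> M (Suc k)"
      proof (rule Suc.IH[OF Suc.prems(1)])
        fix n assume "n \<in> set ns"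
        then show "a n \<in> conjs n (U n) \<and> Suc k \<le> n \<and> n < Suc k + d"
          using Suc.prems(2)[of n] False by (cases "n = k") auto
      qed
      then show ?thesis using M(4) by blast
    next
      case True
      then obtain l r where ns: "ns = l @ k # r" by (meson split_list)
      \<comment> \<open>Since the list is distinct, \<open>k\<close> occurs in neither part, so all
        remaining indices are at least \<open>Suc k\<close>.\<close>
      have bound: "a n \<in> conjs n (U n) \<and> Suc k \<le> n \<and> n < Suc k + d" if "n \<in> set l \<union> set r" for n
        using Suc.prems(1) Suc.prems(2)[of n] that ns by (cases "n = k") auto
      have "\<Phi> (list_prod a l) \<in> M (Suc k)" "\<Phi> (list_prod a r) \<in> M (Suc k)"
        using Suc.prems(1) ns bound by (auto intro!: Suc.IH)
      moreover have "\<Phi> (a k) \<in> M (Suc k)"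
        using Suc.prems(2)[OF True] U(2) by blast
      moreover have "\<Phi> (list_prod a ns) =
          \<Phi> (list_prod a l) \<otimes>\<^bsub>H\<^esub> (\<Phi> (a k) \<otimes>\<^bsub>H\<^esub> \<Phi> (list_prod a r))"
      proof -
        have "list_prod a ns = list_prod a l \<otimes> list_prod a (k # r)"
          unfolding ns by (rule list_prod_append) (use a ns in auto)
        moreover have "list_prod a l \<in> carrier G" "list_prod a r \<in> carrier G" "a k \<in> carrier G"
          using a ns by (auto intro!: list_prod_closed)
        ultimately show ?thesis by simp
      qed
      ultimately show ?thesis using M(5) by simp
    qed
  qed
  have "\<Phi> g \<in> N" if "g \<in> basic_nhd U" for g
    using that
  proof (rule basic_nhdE)
    fix a ns assume g: "g = list_prod a ns" "distinct ns" "\<And>n. n \<in> set ns \<Longrightarrow> a n \<in> conjs n (U n)"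
    \<comment> \<open>All indices lie below \<open>Suc (Max (set ns))\<close>; for the empty list
      this holds vacuously, whatever \<open>Max {}\<close> is.\<close>
    have "\<Phi> (list_prod a ns) \<in> M 0"
      by (rule key[where d = "Suc (Max (set ns))"]) (use g in \<open>auto simp: less_Suc_eq_le\<close>)
    then show ?thesis using M(3) g(1) by blast
  qed
  then show ?thesis using U(1) that by blast
qed

end


section \<open>Compact Hausdorff spaces\<close>

lemma compact_space_finite_cover:
  assumes "compact_space X" "\<And>x. x \<in> topspace X \<Longrightarrow> openin X (U x) \<and> x \<in> U x"
  obtains C where "finite C" "C \<subseteq> topspace X" "topspace X \<subseteq> (\<Union>c\<in>C. U c)"
proof -
  have "\<forall>V\<in>U ` topspace X. openin X V" "topspace X \<subseteq> \<Union>(U ` topspace X)"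
    using assms(2) by blast+
  then obtain \<F> where "finite \<F>" "\<F> \<subseteq> U ` topspace X" "topspace X \<subseteq> \<Union>\<F>"
    using assms(1) unfolding compact_space_alt by meson
  then show ?thesis
    using that finite_subset_image by metis
qed

text \<open>A linear combination of Urysohn functions, each equal to 1 at one point of
  \<open>K\<close> and to 0 at the others.\<close>

lemma continuous_interpolation:
  fixes v :: "'a \<Rightarrow> real"
  assumes X: "compact_space X" "Hausdorff_space X" and K: "finite K" "K \<subseteq> topspace X"
  obtains t where "continuous_map X euclideanreal t" "\<And>x. x \<in> K \<Longrightarrow> t x = v x"
proof -
  have normal: "normal_space X"
    using X by (simp add: compact_Hausdorff_or_regular_imp_normal_space)
  have "\<exists>u. continuous_map X euclideanreal u \<and> u x = (1::real) \<and> (\<forall>y\<in>K - {x}. u y = 0)" if x: "x \<in> K" for x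
  proof -
    have "closedin X {x}" "closedin X (K - {x})"
      using X(2) K x by (auto intro!: closedin_Hausdorff_finite)
    moreover have "disjnt {x} (K - {x})" by (simp add: disjnt_def)
    ultimately obtain u where "continuous_map X euclideanreal u" "u ` {x} \<subseteq> {1::real}" "u ` (K - {x}) \<subseteq> {0}"
      by (rule Urysohn_lemma_alt[OF normal])
    then show ?thesis by (intro exI[of _ u]) auto
  qed
  then obtain u where u: "\<And>x. x \<in> K \<Longrightarrow> continuous_map X euclideanreal (u x)"
    "\<And>x. x \<in> K \<Longrightarrow> u x x = (1::real)" "\<And>x y. x \<in> K \<Longrightarrow> y \<in> K - {x} \<Longrightarrow> u x y = 0"
    by metis
  show ?thesis
  proof (rule that[of "\<lambda>y. \<Sum>x\<in>K. v x * u x y"])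
    show "continuous_map X euclideanreal (\<lambda>y. \<Sum>x\<in>K. v x * u x y)"
      using K u by (intro continuous_map_sum continuous_map_real_mult) auto
    fix y assume y: "y \<in> K"
    have "(\<Sum>x\<in>K. v x * u x y) = (\<Sum>x\<in>K. if x = y then v y else 0)"
      using u y by (intro sum.cong) auto
    then show "(\<Sum>x\<in>K. v x * u x y) = v y" using K y by simp
  qed
qed

text \<open>A point is determined by the basic sets containing it, so a finite base would embed the
  space into a finite power set.\<close>

lemma infinite_base:
  assumes "Hausdorff_space X" "infinite (topspace X)" "base_of_topology X \<B>"
  shows "infinite \<B>"
proof
  assume "finite \<B>"
  then have "finite (Pow \<B>)" by simp
  moreover have "inj_on (\<lambda>x. {V \<in> \<B>. x \<in> V}) (topspace X)"
  proof (rule inj_onI, rule ccontr)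
    fix x y assume xy: "x \<in> topspace X" "y \<in> topspace X" "{V \<in> \<B>. x \<in> V} = {V \<in> \<B>. y \<in> V}" "x \<noteq> y"
    then obtain U where "openin X U" "x \<in> U" "y \<notin> U"
      using assms(1) unfolding Hausdorff_space_def disjnt_iff by meson
    then obtain V where "V \<in> \<B>" "x \<in> V" "y \<notin> V"
      using assms(3) unfolding base_of_topology_def by blast
    then show False using xy(3) by blast
  qed
  ultimately show False
    using assms(2) inj_on_finite[of "\<lambda>x. {V \<in> \<B>. x \<in> V}" "topspace X" "Pow \<B>"] by blast
qed

text \<open>When \<open>V\<close> has its closure inside \<open>W\<close>, the condition holds on
  the square of \<open>W\<close> and on the square of the complement of that closure, and these
  cover the diagonal. Other pairs impose nothing, so the index can be an arbitrary finite subset of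
  \<open>\<B> \<times> \<B>\<close>.\<close>

definition base_entourage :: "'a topology \<Rightarrow> ('a set \<times> 'a set) set \<Rightarrow> ('a \<times> 'a) set" where
  "base_entourage X F = {(x, y). x \<in> topspace X \<and> y \<in> topspace X \<and>
     (\<forall>(V, W)\<in>F. X closure_of V \<subseteq> W \<longrightarrow> (x \<in> V \<longrightarrow> y \<in> W) \<and> (y \<in> V \<longrightarrow> x \<in> W))}"

lemma base_entourage_antimono: "F \<subseteq> F' \<Longrightarrow> base_entourage X F' \<subseteq> base_entourage X F"
  unfolding base_entourage_def by blast

lemma entourage_base_entourage:
  assumes "finite F" "\<And>V W. (V, W) \<in> F \<Longrightarrow> openin X V \<and> openin X W"
  shows "entourage X (base_entourage X F)"
  using assms
proof (induction F)
  case empty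
  have "entourage X (topspace X \<times> topspace X)"
    unfolding entourage_def by (auto intro!: exI[of _ "topspace X"])
  then show ?case
    by (rule entourage_mono) (auto simp: base_entourage_def)
next
  case (insert p F)
  obtain V W where p: "p = (V, W)" by (cases p)
  have V: "openin X V" "openin X W" using insert.prems p by auto
  let ?E = "{(x, y). X closure_of V \<subseteq> W \<longrightarrow> (x \<in> V \<longrightarrow> y \<in> W) \<and> (y \<in> V \<longrightarrow> x \<in> W)}"
  have "entourage X ?E"
    unfolding entourage_def
  proof
    fix x assume x: "x \<in> topspace X"
    show "\<exists>U. openin X U \<and> x \<in> U \<and> U \<times> U \<subseteq> ?E"
    proof (cases "x \<in> X closure_of V \<and> X closure_of V \<subseteq> W")
      case True
      then show ?thesis using V by (intro exI[of _ W]) auto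
    next
      case False
      let ?U = "if X closure_of V \<subseteq> W then topspace X - X closure_of V else topspace X"
      have "V \<subseteq> X closure_of V"
        using V(1) by (simp add: closure_of_subset openin_subset)
      then have "?U \<times> ?U \<subseteq> ?E" by auto
      moreover have "openin X ?U" by auto
      ultimately show ?thesis using False x by (intro exI[of _ ?U]) auto
    qed
  qed
  moreover have "entourage X (base_entourage X F)" using insert by blast
  ultimately have "entourage X (?E \<inter> base_entourage X F)" by (rule entourage_Int)
  then show ?case
    by (rule entourage_mono) (auto simp: base_entourage_def p)
qed

text \<open>Regularity gives around each point basic sets \<open>V\<close>, \<open>W\<close> with
  the closure of \<open>V\<close> inside \<open>W\<close> and the square of \<open>W\<close> inside
  \<open>E\<close>. Finitely many \<open>V c\<close> cover the space, and \<open>x \<in> V c\<close>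
  puts both \<open>x\<close> and \<open>y\<close> into \<open>W c\<close>.\<close>

lemma base_entourage_cofinal:
  assumes X: "compact_space X" "Hausdorff_space X" and \<B>: "base_of_topology X \<B>"
    and E: "entourage X E"
  obtains F where "F \<in> Fpow (\<B> \<times> \<B>)" "base_entourage X F \<subseteq> E"
proof -
  have reg: "regular_space X" using X by (simp add: compact_Hausdorff_imp_regular_space)
  have "\<exists>V W. V \<in> \<B> \<and> W \<in> \<B> \<and> x \<in> V \<and> X closure_of V \<subseteq> W \<and> W \<times> W \<subseteq> E" if x: "x \<in> topspace X" for x
  proof -
    obtain U where U: "openin X U" "x \<in> U" "U \<times> U \<subseteq> E"
      using E x unfolding entourage_def by blast
    then obtain W where W: "W \<in> \<B>" "x \<in> W" "W \<subseteq> U"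
      using \<B> unfolding base_of_topology_def by meson
    then have "closedin X (topspace X - W)" using \<B> unfolding base_of_topology_def by blast
    then obtain U' where U': "openin X U'" "x \<in> U'" "disjnt (topspace X - W) (X closure_of U')"
      using reg x W(2) unfolding regular_space by (metis DiffE DiffI)
    then obtain V where V: "V \<in> \<B>" "x \<in> V" "V \<subseteq> U'"
      using \<B> unfolding base_of_topology_def by meson
    have "X closure_of V \<subseteq> W"
      using closure_of_mono[OF V(3), of X] U'(3) closure_of_subset_topspace[of X V]
      unfolding disjnt_iff by blast
    moreover have "W \<times> W \<subseteq> E" using W(3) U(3) by (meson Sigma_mono subset_trans)
    ultimately show ?thesis using V(1,2) W(1) by (intro exI[of _ V] exI[of _ W] conjI)
  qed
  then obtain V W where VW: "\<And>x. x \<in> topspace X \<Longrightarrow>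
      V x \<in> \<B> \<and> W x \<in> \<B> \<and> x \<in> V x \<and> X closure_of V x \<subseteq> W x \<and> W x \<times> W x \<subseteq> E"
    by metis
  have "openin X (V x) \<and> x \<in> V x" if "x \<in> topspace X" for x
    using VW[OF that] \<B> unfolding base_of_topology_def by blast
  then obtain C where C: "finite C" "C \<subseteq> topspace X" "topspace X \<subseteq> (\<Union>c\<in>C. V c)"
    by (rule compact_space_finite_cover[OF X(1)])
  let ?F = "(\<lambda>c. (V c, W c)) ` C"
  have "?F \<subseteq> \<B> \<times> \<B>" using VW C(2) by blast
  then have "?F \<in> Fpow (\<B> \<times> \<B>)"
    using C(1) unfolding Fpow_def by blast
  moreover have "base_entourage X ?F \<subseteq> E"
  proof
    fix p assume p: "p \<in> base_entourage X ?F"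
    obtain x y where xy: "p = (x, y)" by (cases p)
    have xX: "x \<in> topspace X" and yX: "y \<in> topspace X"
      using p xy by (auto simp: base_entourage_def)
    obtain c where c: "c \<in> C" "x \<in> V c" using C(3) xX by blast
    then have cX: "c \<in> topspace X" using C(2) by blast
    have "x \<in> W c"
      using VW[OF cX] c(2) xX closure_of_subset_Int[of X "V c"] by blast
    moreover have "y \<in> W c"
      using p c VW[OF cX] unfolding xy base_entourage_def by blast
    ultimately show "p \<in> E" using VW[OF cX] xy by blast
  qed
  ultimately show ?thesis by (rule that)
qed

section \<open>Separated families of functions into the unit interval\<close>

definition unit_functions :: "'a topology \<Rightarrow> ('a \<Rightarrow> real) set" where
  "unit_functions X = {f. continuous_map X euclideanreal f \<and> f ` topspace X \<subseteq> {0..1}}"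

definition separated_functions :: "'a topology \<Rightarrow> ('a \<Rightarrow> real) set \<Rightarrow> bool" where
  "separated_functions X S \<longleftrightarrow> S \<subseteq> unit_functions X \<and>
     (\<forall>f\<in>S. \<forall>g\<in>S. f \<noteq> g \<longrightarrow> (\<exists>x\<in>topspace X. \<bar>f x - g x\<bar> \<ge> 1 / 3))"

text \<open>By Zorn's lemma. A function at distance at least 1/3 from every member could be added to
  a maximal family, yet a member is at distance 0 from itself.\<close>

lemma maximal_separated_functions:
  obtains S where "separated_functions X S"
    "\<And>g. g \<in> unit_functions X \<Longrightarrow> \<exists>f\<in>S. \<forall>x\<in>topspace X. \<bar>f x - g x\<bar> < 1 / 3"
proof -
  have "\<exists>S\<in>Collect (separated_functions X). \<forall>S'\<in>Collect (separated_functions X). S \<subseteq> S' \<longrightarrow> S' = S"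
  proof (rule subset_Zorn')
    fix \<C> assume \<C>: "subset.chain (Collect (separated_functions X)) \<C>"
    have sep: "separated_functions X S" if "S \<in> \<C>" for S
      using \<C> that unfolding subset.chain_def by blast
    have "\<exists>x\<in>topspace X. \<bar>f x - g x\<bar> \<ge> 1 / 3" if fg: "f \<in> \<Union>\<C>" "g \<in> \<Union>\<C>" "f \<noteq> g" for f g
    proof -
      obtain S1 S2 where "S1 \<in> \<C>" "S2 \<in> \<C>" "f \<in> S1" "g \<in> S2" using fg by blast
      moreover from this have "S1 \<subseteq> S2 \<or> S2 \<subseteq> S1"
        using \<C> unfolding subset_chain_def by blast
      ultimately obtain S where "S \<in> \<C>" "f \<in> S" "g \<in> S" by blast
      then show ?thesis using sep fg(3) unfolding separated_functions_def by blast
    qed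
    moreover have "\<Union>\<C> \<subseteq> unit_functions X"
      using sep unfolding separated_functions_def by blast
    ultimately show "\<Union>\<C> \<in> Collect (separated_functions X)"
      unfolding separated_functions_def by blast
  qed
  then obtain S where S: "separated_functions X S"
    and max: "\<And>S'. \<lbrakk>separated_functions X S'; S \<subseteq> S'\<rbrakk> \<Longrightarrow> S' = S"
    by blast
  have "\<exists>f\<in>S. \<forall>x\<in>topspace X. \<bar>f x - g x\<bar> < 1 / 3" if g: "g \<in> unit_functions X" for g
  proof (rule ccontr)
    assume no: "\<not> ?thesis"
    then have far: "\<exists>x\<in>topspace X. \<bar>f x - g x\<bar> \<ge> 1 / 3" if "f \<in> S" for f
      using that by (meson not_le)
    then have far': "\<exists>x\<in>topspace X. \<bar>g x - f x\<bar> \<ge> 1 / 3" if "f \<in> S" for f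
      using that by (simp add: abs_minus_commute)
    have "separated_functions X (insert g S)"
      using S g far far' unfolding separated_functions_def by blast
    then have "g \<in> S" using max by blast
    then show False using no by (force intro: bexI[of _ g])
  qed
  then show ?thesis using S that by blast
qed

text \<open>Approximate a Urysohn function with value 1 at \<open>x\<close> and 0 off
  \<open>U\<close>: its approximant exceeds 2/3 at \<open>x\<close> and stays below 1/3 off
  \<open>U\<close>, so the level 1/2 tells them apart.\<close>

lemma base_of_maximal_separated_functions:
  assumes X: "compact_space X" "Hausdorff_space X" and S: "S \<subseteq> unit_functions X"
    and dense: "\<And>g. g \<in> unit_functions X \<Longrightarrow> \<exists>f\<in>S. \<forall>x\<in>topspace X. \<bar>f x - g x\<bar> < 1 / 3"
  shows "base_of_topology X ((\<lambda>f. {x \<in> topspace X. f x \<in> {1/2<..}}) ` S)"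
  unfolding base_of_topology_def
proof (intro conjI ballI allI impI)
  fix V assume "V \<in> (\<lambda>f. {x \<in> topspace X. f x \<in> {1/2<..}}) ` S"
  then obtain f where "f \<in> S" and V: "V = {x \<in> topspace X. f x \<in> {1/2<..}}" by blast
  then have "continuous_map X euclideanreal f" using S unfolding unit_functions_def by blast
  then show "openin X V" unfolding V by (rule openin_continuous_map_preimage) simp
next
  fix U x assume U: "openin X U \<and> x \<in> U"
  then have x: "x \<in> topspace X" using openin_subset by blast
  have "normal_space X" using X by (simp add: compact_Hausdorff_or_regular_imp_normal_space)
  moreover have "closedin X (topspace X - U)" "closedin X {x}"
    using U closedin_Hausdorff_finite[OF X(2), of "{x}"] x by auto
  moreover have "disjnt (topspace X - U) {x}" using U by (simp add: disjnt_def)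
  ultimately obtain g where g: "continuous_map X (top_of_set {0..1::real}) g"
    "g ` (topspace X - U) \<subseteq> {0}" "g ` {x} \<subseteq> {1}"
    by (rule Urysohn_lemma) (rule zero_le_one)
  have "g \<in> unit_functions X"
    using g(1) unfolding unit_functions_def continuous_map_in_subtopology by auto
  then obtain f where f: "f \<in> S" "\<And>y. y \<in> topspace X \<Longrightarrow> \<bar>f y - g y\<bar> < 1 / 3"
    using dense by blast
  have "g x = 1" using g(3) by simp
  then have "f x > 1 / 2" using f(2)[OF x] by linarith
  moreover have "y \<in> U" if "y \<in> topspace X" "f y > 1 / 2" for y
  proof (rule ccontr)
    assume "y \<notin> U"
    then have "g y = 0" using g(2) that(1) by blast
    then show False using f(2)[OF that(1)] that(2) by linarith
  qed
  ultimately show "\<exists>V\<in>(\<lambda>f. {x \<in> topspace X. f x \<in> {1/2<..}}) ` S. x \<in> V \<and> V \<subseteq> U"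
    using f(1) x by (intro bexI[of _ "{x \<in> topspace X. f x \<in> {1/2<..}}"]) auto
qed

text \<open>Such functions are determined by their approximate values at finitely many points.\<close>

lemma finite_equicontinuous_separated_functions:
  assumes X: "compact_space X" and S: "separated_functions X S" and E: "entourage X E"
  shows "finite {f \<in> S. \<forall>x\<in>topspace X. \<forall>y\<in>topspace X. (x, y) \<in> E \<longrightarrow> \<bar>f x - f y\<bar> \<le> 1 / 16}"
    (is "finite ?S")
proof -
  obtain U where U: "\<And>x. x \<in> topspace X \<Longrightarrow> openin X (U x) \<and> x \<in> U x \<and> U x \<times> U x \<subseteq> E"
    using E unfolding entourage_def by metis
  then have "\<And>x. x \<in> topspace X \<Longrightarrow> openin X (U x) \<and> x \<in> U x" by blast
  then obtain C where C: "finite C" "C \<subseteq> topspace X" "topspace X \<subseteq> (\<Union>c\<in>C. U c)"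
    by (rule compact_space_finite_cover[OF X])
  \<comment> \<open>The values at the centres, rounded to steps of 1/16, form a code with finitely
    many possibilities.\<close>
  define \<beta> where "\<beta> f = restrict (\<lambda>c. \<lfloor>16 * f c\<rfloor>) C" for f :: "'a \<Rightarrow> real"
  show ?thesis
  proof (rule inj_on_finite[of \<beta>])
    show "finite (PiE C (\<lambda>_. {0..16::int}))" using C(1) by (intro finite_PiE) auto
    show "\<beta> ` ?S \<subseteq> PiE C (\<lambda>_. {0..16})"
    proof (rule image_subsetI)
      fix f assume "f \<in> ?S"
      then have "f \<in> unit_functions X" using S unfolding separated_functions_def by blast
      then have "0 \<le> f c \<and> f c \<le> 1" if "c \<in> C" for c
        using C(2) that unfolding unit_functions_def by (auto simp: image_subset_iff)
      then have "\<lfloor>16 * f c\<rfloor> \<in> {0..16}" if "c \<in> C" for c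
        using that by (simp add: floor_le_iff) fastforce
      then show "\<beta> f \<in> PiE C (\<lambda>_. {0..16})" unfolding \<beta>_def by auto
    qed
    show "inj_on \<beta> ?S"
    proof (rule inj_onI, rule ccontr)
      fix f g assume f: "f \<in> ?S" and g: "g \<in> ?S" and eq: "\<beta> f = \<beta> g" and "f \<noteq> g"
      then obtain x where x: "x \<in> topspace X" "\<bar>f x - g x\<bar> \<ge> 1 / 3"
        using S unfolding separated_functions_def by blast
      then obtain c where c: "c \<in> C" "x \<in> U c" using C(3) by blast
      have cX: "c \<in> topspace X" using c C(2) by blast
      then have "(x, c) \<in> E" using U[OF cX] c(2) by blast
      then have "\<bar>f x - f c\<bar> \<le> 1 / 16" "\<bar>g x - g c\<bar> \<le> 1 / 16"
        using f g x(1) cX by blast+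
      moreover have "\<lfloor>16 * f c\<rfloor> = \<lfloor>16 * g c\<rfloor>"
        using fun_cong[OF eq, of c] c(1) by (simp add: \<beta>_def)
      \<comment> \<open>Equal codes give a difference below 1/16 at \<open>c\<close>; with the two
        oscillations this stays below 3/16, contradicting the separation by 1/3.\<close>
      then have "\<bar>16 * f c - 16 * g c\<bar> < 1" by linarith
      ultimately show False using x(2) by linarith
    qed
  qed
qed

section \<open>The neighbourhood filter of the finest group topology\<close>

definition add_reals :: "real monoid" where
  "add_reals = \<lparr>carrier = UNIV, monoid.mult = (+), one = 0\<rparr>"

lemma add_reals_simps [simp]:
  "carrier add_reals = UNIV" "x \<otimes>\<^bsub>add_reals\<^esub> y = x + y" "\<one>\<^bsub>add_reals\<^esub> = 0"
  by (simp_all add: add_reals_def)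

lemma group_add_reals: "group add_reals"
  by (rule groupI) (auto intro: exI[of _ "- x" for x])

lemma (in group) group_hom_add_reals: "h \<in> hom G add_reals \<Longrightarrow> group_hom G add_reals h"
  by (intro group_hom.intro group_hom_axioms.intro group_add_reals is_group)

lemma inv_add_reals [simp]: "inv\<^bsub>add_reals\<^esub> x = - x"
  by (rule group.inv_equality[OF group_add_reals]) auto

lemma topological_group_add_reals: "topological_group add_reals euclideanreal"
proof (intro topological_group.intro group_add_reals topological_group_axioms.intro)
  show "continuous_map (prod_topology euclideanreal euclideanreal) euclideanreal
      (\<lambda>(x, y). x \<otimes>\<^bsub>add_reals\<^esub> y)"
    by (auto simp: case_prod_unfold intro!: continuous_intros)
  show "continuous_map euclideanreal euclideanreal (\<lambda>x. inv\<^bsub>add_reals\<^esub> x)"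
    by (simp add: continuous_on_minus)
qed auto

lemma sum_half_powers_le: "finite A \<Longrightarrow> (\<Sum>n\<in>A. 1 / 2 ^ Suc n) \<le> (1::real)"
proof -
  assume A: "finite A"
  have "(\<Sum>n<k. 1 / 2 ^ Suc n) = 1 - 1 / (2::real) ^ k" for k
    by (induction k) (auto simp: field_simps)
  moreover have "(\<Sum>n\<in>A. 1 / 2 ^ Suc n) \<le> (\<Sum>n<Suc (Max A). 1 / (2::real) ^ Suc n)"
    using A by (intro sum_mono2) (auto simp: less_Suc_eq_le)
  ultimately show ?thesis
    using zero_le_power[of "2::real" "Suc (Max A)"] by (smt (verit) divide_nonneg_nonneg)
qed

text \<open>The two properties of free groups that the comparison uses: \<open>separated\<close>
  makes the constructed topology Hausdorff, and \<open>extension\<close> supplies the real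
  homomorphisms for the lower bound.\<close>

locale free_type_group = compactly_generated_group +
  assumes Hausdorff_X: "Hausdorff_space X"
    and separated: "\<And>g. \<lbrakk>g \<in> carrier G; g \<noteq> \<one>\<rbrakk> \<Longrightarrow> \<exists>U. (\<forall>n. entourage X (U n)) \<and> g \<notin> basic_nhd U"
    and extension: "\<And>s. continuous_map X euclideanreal s \<Longrightarrow> \<exists>h\<in>hom G add_reals. \<forall>x\<in>topspace X. h (\<iota> x) = s x"
begin

abbreviation T where "T \<equiv> finest_group_topology X G \<iota>"

lemma topological_group_basic_nhds: "topological_group G (filter_topology basic_nhds)"
proof (rule topological_group_filter_topology[OF group_filter_base_basic_nhds])
  show "\<Inter>basic_nhds \<subseteq> {\<one>}"
  proof
    fix g assume g: "g \<in> \<Inter>basic_nhds"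
    then have "g \<in> carrier G"
      using basic_nhd_closed basic_nhdsI[OF entourage_UNIV] by blast
    then show "g \<in> {\<one>}"
      using separated g basic_nhdsI by blast
  qed
qed

sublocale top: topological_group G T
  using finest_group_topology(1)[OF topological_group_basic_nhds continuous_map_basic_nhds] .

lemma continuous_gen: "continuous_map X T \<iota>"
  using finest_group_topology(2)[OF topological_group_basic_nhds continuous_map_basic_nhds] .

text \<open>The topology built from the basic neighbourhoods is itself a group topology making
  \<open>\<iota>\<close> continuous, so the finest one contains its open sets.\<close>

lemma basic_nhd_in_nhds:
  assumes "\<And>n. entourage X (U n)"
  shows "basic_nhd U \<in> Field (nhds_order T \<one>)"
proof -
  obtain V where V: "openin (filter_topology basic_nhds) V" "\<one> \<in> V" "V \<subseteq> basic_nhd U"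
    by (rule openin_filter_topology_base[OF group_filter_base_basic_nhds basic_nhdsI[OF assms]])
  then have "openin T V"
    using openin_finest_group_topology[OF topological_group_basic_nhds continuous_map_basic_nhds]
    by blast
  then show ?thesis
    using V basic_nhd_closed unfolding Field_nhds_order top.topspace_eq by blast
qed

text \<open>The identity homomorphism into \<open>G\<close> with its finest topology, fed into
  \<open>hom_basic_nhd\<close>.\<close>

lemma basic_nhd_cofinal:
  assumes "N \<in> Field (nhds_order T \<one>)"
  obtains U where "\<And>n. entourage X (U n)" "basic_nhd U \<subseteq> N"
proof -
  obtain V where V: "openin T V" "\<one> \<in> V" "V \<subseteq> N"
    using assms unfolding Field_nhds_order by blast
  have id: "(\<lambda>g. g) \<in> hom G G" by (rule homI) auto
  obtain U where "\<And>n. entourage X (U n)" "\<And>g. g \<in> basic_nhd U \<Longrightarrow> g \<in> V"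
    by (rule hom_basic_nhd[OF top.topological_group_axioms id continuous_gen V(1,2)]) blast
  then show ?thesis using that V(3) by blast
qed

text \<open>Larger finite sets give smaller entourages, hence smaller basic neighbourhoods. Each
  neighbourhood \<open>N\<close> is assigned a sequence \<open>\<psi> N\<close> whose basic
  neighbourhood lies in \<open>N\<close>, and every larger sequence then works as well.\<close>

lemma nhds_order_le_omega_power:
  assumes \<B>: "base_of_topology X \<B>"
  shows "nhds_order T \<one> \<le>\<^sub>T omega_power (finite_subsets_order (\<B> \<times> \<B>))"
proof -
  have "\<exists>f. (\<forall>n. f n \<in> Fpow (\<B> \<times> \<B>)) \<and> basic_nhd (\<lambda>n. base_entourage X (f n)) \<subseteq> N"
    if N: "N \<in> Field (nhds_order T \<one>)" for N
  proof -
    obtain U where U: "\<And>n. entourage X (U n)" "basic_nhd U \<subseteq> N"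
      by (rule basic_nhd_cofinal[OF N]) blast
    have "\<exists>F. F \<in> Fpow (\<B> \<times> \<B>) \<and> base_entourage X F \<subseteq> U n" for n
      using base_entourage_cofinal[OF compact Hausdorff_X \<B> U(1)] by metis
    then obtain f where f: "\<And>n. f n \<in> Fpow (\<B> \<times> \<B>)" "\<And>n. base_entourage X (f n) \<subseteq> U n"
      by metis
    have "basic_nhd (\<lambda>n. base_entourage X (f n)) \<subseteq> N"
      using basic_nhd_mono[of "\<lambda>n. base_entourage X (f n)" U, OF f(2)] U(2) by (rule subset_trans)
    then show ?thesis using f(1) by blast
  qed
  then obtain \<psi> where \<psi>: "\<And>N n. N \<in> Field (nhds_order T \<one>) \<Longrightarrow> \<psi> N n \<in> Fpow (\<B> \<times> \<B>)"
    "\<And>N. N \<in> Field (nhds_order T \<one>) \<Longrightarrow> basic_nhd (\<lambda>n. base_entourage X (\<psi> N n)) \<subseteq> N"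
    by metis
  have nhd: "basic_nhd (\<lambda>n. base_entourage X (f n)) \<in> Field (nhds_order T \<one>)"
    if f: "f \<in> Field (omega_power (finite_subsets_order (\<B> \<times> \<B>)))" for f
  proof (rule basic_nhd_in_nhds, rule entourage_base_entourage)
    fix n
    have fn: "f n \<in> Fpow (\<B> \<times> \<B>)" using f unfolding Field_omega_power_finite_subsets by blast
    then show "finite (f n)" unfolding Fpow_def by blast
    fix V W assume "(V, W) \<in> f n"
    then show "openin X V \<and> openin X W"
      using fn \<B> unfolding Fpow_def base_of_topology_def by blast
  qed
  show ?thesis
  proof (rule tukey_leI[where \<psi> = \<psi> and \<phi> = "\<lambda>f. basic_nhd (\<lambda>n. base_entourage X (f n))"])
    fix N assume N: "N \<in> Field (nhds_order T \<one>)"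
    show "\<psi> N \<in> Field (omega_power (finite_subsets_order (\<B> \<times> \<B>)))"
      using \<psi>(1)[OF N] unfolding Field_omega_power_finite_subsets by simp
    fix f assume f: "f \<in> Field (omega_power (finite_subsets_order (\<B> \<times> \<B>)))"
      and le: "(\<psi> N, f) \<in> omega_power (finite_subsets_order (\<B> \<times> \<B>))"
    have "\<psi> N n \<subseteq> f n" for n
      using le unfolding omega_power_finite_subsets_iff by blast
    then have "basic_nhd (\<lambda>n. base_entourage X (f n)) \<subseteq> basic_nhd (\<lambda>n. base_entourage X (\<psi> N n))"
      by (intro basic_nhd_mono base_entourage_antimono)
    then show "(N, basic_nhd (\<lambda>n. base_entourage X (f n))) \<in> nhds_order T \<one>"
      using \<psi>(2)[OF N] nhd[OF f] N unfolding nhds_order_iff by blast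
  qed (rule nhd)
qed

section \<open>The lower bound through real homomorphisms\<close>

lemma hom_add_reals_conjs:
  assumes h: "h \<in> hom G add_reals" "\<And>x. x \<in> topspace X \<Longrightarrow> h (\<iota> x) = s x"
    and g: "g \<in> conjs n E"
  obtains x y where "x \<in> topspace X" "y \<in> topspace X" "(x, y) \<in> E" "h g = s y - s x"
proof -
  interpret h: group_hom G add_reals h
    using h(1) by (rule group_hom_add_reals)
  show ?thesis
    using g
  proof (rule conjsE)
    fix k x y assume "g = k \<otimes> (inv \<iota> x \<otimes> \<iota> y) \<otimes> inv k" "k \<in> words n"
      and xy: "x \<in> topspace X" "y \<in> topspace X" "(x, y) \<in> E"
    \<comment> \<open>The reals are commutative, so the conjugator cancels.\<close>
    then have "h g = s y - s x"
      using words_closed[of k n] gen_closed h(2) by simp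
    then show ?thesis using that xy by blast
  qed
qed

text \<open>The factor of index \<open>n\<close> contributes at most
  \<open>2 ^ m / 2 ^ Suc n\<close> to \<open>h s g\<close> when \<open>s \<in> F m\<close>, and
  these contributions sum to at most \<open>2 ^ m\<close>.\<close>

lemma functional_bounds_nhd:
  assumes S: "S \<subseteq> unit_functions X" and F: "\<And>m. finite (F m)" "\<And>m. F m \<subseteq> S"
    and h: "\<And>s. s \<in> S \<Longrightarrow> h s \<in> hom G add_reals" "\<And>s x. s \<in> S \<Longrightarrow> x \<in> topspace X \<Longrightarrow> h s (\<iota> x) = s x"
  shows "{g \<in> carrier G. \<forall>m. \<forall>s\<in>F m. \<bar>h s g\<bar> \<le> 2 ^ m} \<in> Field (nhds_order T \<one>)" (is "?N \<in> _")
proof -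
  let ?E = "\<lambda>s \<epsilon>. {(x, y). \<bar>s y - s x\<bar> \<le> \<epsilon>}"
  have ent: "entourage X (?E s \<epsilon>)" if s: "s \<in> S" and \<epsilon>: "\<epsilon> > 0" for s \<epsilon>
  proof -
    interpret R: topological_group add_reals euclideanreal by (rule topological_group_add_reals)
    have "continuous_map X euclideanreal s" using S s unfolding unit_functions_def by blast
    from R.entourage_left_quotient[OF this, of "ball 0 \<epsilon>"] \<epsilon>
    have "entourage X {(x, y). inv\<^bsub>add_reals\<^esub> s x \<otimes>\<^bsub>add_reals\<^esub> s y \<in> ball 0 \<epsilon>}" by simp
    then show ?thesis by (rule entourage_mono) auto
  qed
  \<comment> \<open>Only levels \<open>m \<le> n\<close> are constrained, so \<open>U n\<close>
    involves finitely many functions and remains an entourage.\<close>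
  define U where "U n = {(x, y). \<forall>m\<le>n. \<forall>s\<in>F m. \<bar>s y - s x\<bar> \<le> 2 ^ m * (1 / 2 ^ Suc n)}" for n
  have fin: "entourage X {(x, y). \<forall>p\<in>P. \<bar>fst p y - fst p x\<bar> \<le> snd p}"
    if "finite P" "\<And>p. p \<in> P \<Longrightarrow> fst p \<in> S \<and> snd p > 0" for P
    using that
  proof (induction P)
    case empty
    then show ?case using entourage_UNIV by simp
  next
    case (insert p P)
    then have "entourage X ({(x, y). \<bar>fst p y - fst p x\<bar> \<le> snd p} \<inter>
        {(x, y). \<forall>p\<in>P. \<bar>fst p y - fst p x\<bar> \<le> snd p})"
      by (intro entourage_Int ent) auto
    then show ?case by (rule entourage_mono) auto
  qed
  have U: "entourage X (U n)" for n
  proof -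
    let ?P = "\<Union>m\<le>n. (\<lambda>s. (s, 2 ^ m * (1 / 2 ^ Suc n))) ` F m"
    have "entourage X {(x, y). \<forall>p\<in>?P. \<bar>fst p y - fst p x\<bar> \<le> snd p}"
      using F(1) subsetD[OF F(2)] by (intro fin) auto
    then show ?thesis by (rule entourage_mono) (auto simp: U_def)
  qed
  have "basic_nhd U \<subseteq> ?N"
  proof
    fix g assume g: "g \<in> basic_nhd U"
    have "\<bar>h s g\<bar> \<le> 2 ^ m" if s: "s \<in> F m" for m s
    proof -
      have sS: "s \<in> S" using s F(2) by blast
      interpret h: group_hom G add_reals "h s"
        using h(1)[OF sS] by (rule group_hom_add_reals)
      show ?thesis
        using g
      proof (rule basic_nhdE)
        fix a ns assume g: "g = list_prod a ns" "distinct ns" "\<And>n. n \<in> set ns \<Longrightarrow> a n \<in> conjs n (U n)"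
          "\<And>n. n \<in> set ns \<Longrightarrow> a n \<in> carrier G"
        have bound: "\<bar>h s (a n)\<bar> \<le> 2 ^ m * (1 / 2 ^ Suc n)" if n: "n \<in> set ns" for n
        proof -
          obtain x y where xy: "x \<in> topspace X" "y \<in> topspace X" "(x, y) \<in> U n" "h s (a n) = s y - s x"
            using hom_add_reals_conjs[OF h(1)[OF sS] h(2)[OF sS] g(3)[OF n]] by metis
          show ?thesis
          proof (cases "m \<le> n")
            case True
            then show ?thesis using xy(3,4) s by (auto simp: U_def)
          next
            case False
            \<comment> \<open>For \<open>n < m\<close> the entourage says nothing about
              \<open>s\<close>, but the permitted contribution is then at least 1, the largest
              possible oscillation of \<open>s\<close>.\<close>
            have "s x \<in> {0..1}" "s y \<in> {0..1}"
              using S sS xy(1,2) unfolding unit_functions_def by blast+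
            then have "\<bar>h s (a n)\<bar> \<le> 1" using xy(4) by auto
            also have "1 \<le> 2 ^ m * (1 / (2::real) ^ Suc n)"
              using False power_increasing[of "Suc n" m "2::real"] by (simp add: field_simps)
            finally show ?thesis .
          qed
        qed
        have "h s (list_prod a ms) = (\<Sum>n\<leftarrow>ms. h s (a n))" if "set ms \<subseteq> set ns" for ms
          using that
        proof (induction ms)
          case (Cons n ms)
          then have "a n \<in> carrier G" "list_prod a ms \<in> carrier G"
            using g(4) by (auto intro!: list_prod_closed)
          then show ?case using Cons by simp
        qed (use h.hom_one in simp)
        then have "h s g = (\<Sum>n\<in>set ns. h s (a n))"
          using g(1,2) by (simp add: sum_list_distinct_conv_sum_set)
        also have "\<bar>\<dots>\<bar> \<le> (\<Sum>n\<in>set ns. \<bar>h s (a n)\<bar>)" by (rule sum_abs)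
        also have "\<dots> \<le> (\<Sum>n\<in>set ns. 2 ^ m * (1 / 2 ^ Suc n))" using bound by (rule sum_mono)
        also have "\<dots> = 2 ^ m * (\<Sum>n\<in>set ns. 1 / 2 ^ Suc n)" by (rule sum_distrib_left[symmetric])
        also have "\<dots> \<le> 2 ^ m * 1" by (intro mult_left_mono sum_half_powers_le) auto
        finally show ?thesis by simp
      qed
    qed
    then show "g \<in> ?N" using g basic_nhd_closed by blast
  qed
  moreover have "basic_nhd U \<in> Field (nhds_order T \<one>)" using U by (rule basic_nhd_in_nhds)
  moreover have "?N \<subseteq> carrier G" by blast
  ultimately show ?thesis unfolding Field_nhds_order top.topspace_eq by blast
qed

lemma omega_power_le_nhds_order:
  assumes S: "separated_functions X S"
  shows "omega_power (finite_subsets_order S) \<le>\<^sub>T nhds_order T \<one>"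
proof -
  have SU: "S \<subseteq> unit_functions X" using S unfolding separated_functions_def by blast
  then have "\<exists>h. h \<in> hom G add_reals \<and> (\<forall>x\<in>topspace X. h (\<iota> x) = s x)" if "s \<in> S" for s
    using extension[of s] that unfolding unit_functions_def by blast
  then obtain h where h: "\<And>s. s \<in> S \<Longrightarrow> h s \<in> hom G add_reals"
      "\<And>s x. s \<in> S \<Longrightarrow> x \<in> topspace X \<Longrightarrow> h s (\<iota> x) = s x"
    by metis
  \<comment> \<open>A bound \<open>2 ^ m\<close> on \<open>h s\<close> at the power with exponent
    \<open>2 ^ (m + 4)\<close> gives 1/16 at the element itself. Membership in a set of pairs is
    spelled out to match \<open>finite_equicontinuous_separated_functions\<close>.\<close>
  define \<phi> where "\<phi> N m = {s \<in> S. \<forall>x\<in>topspace X. \<forall>y\<in>topspace X.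
      (x, y) \<in> {(x, y). (inv \<iota> x \<otimes> \<iota> y) [^] (2 ^ (m + 4) :: nat) \<in> N} \<longrightarrow> \<bar>s x - s y\<bar> \<le> 1 / 16}" for N m
  have fin: "finite (\<phi> N m)" if N: "N \<in> Field (nhds_order T \<one>)" for N m
    unfolding \<phi>_def
  proof (rule finite_equicontinuous_separated_functions[OF compact S])
    obtain V where V: "openin T V" "\<one> \<in> V" "V \<subseteq> N"
      using N unfolding Field_nhds_order by blast
    let ?W = "{g \<in> topspace T. g [^] (2 ^ (m + 4) :: nat) \<in> V}"
    have "openin T ?W" using top.continuous_map_pow V(1) by (rule openin_continuous_map_preimage)
    moreover have "\<one> \<in> ?W" using V(2) by (simp add: top.topspace_eq)
    ultimately have "entourage X {(x, y). inv \<iota> x \<otimes> \<iota> y \<in> ?W}"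
      by (rule top.entourage_left_quotient[OF continuous_gen])
    then show "entourage X {(x, y). (inv \<iota> x \<otimes> \<iota> y) [^] (2 ^ (m + 4) :: nat) \<in> N}"
      by (rule entourage_mono) (use V(3) in auto)
  qed
  show ?thesis
  proof (rule tukey_leI[where \<phi> = \<phi> and
        \<psi> = "\<lambda>F. {g \<in> carrier G. \<forall>m. \<forall>s\<in>F m. \<bar>h s g\<bar> \<le> 2 ^ m}"])
    fix F assume F: "F \<in> Field (omega_power (finite_subsets_order S))"
    then have F': "finite (F m)" "F m \<subseteq> S" for m
      unfolding Field_omega_power_finite_subsets Fpow_def by blast+
    then show "{g \<in> carrier G. \<forall>m. \<forall>s\<in>F m. \<bar>h s g\<bar> \<le> 2 ^ m} \<in> Field (nhds_order T \<one>)"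
      using functional_bounds_nhd[OF SU _ _ h] by blast
    fix N assume N: "N \<in> Field (nhds_order T \<one>)"
      and le: "({g \<in> carrier G. \<forall>m. \<forall>s\<in>F m. \<bar>h s g\<bar> \<le> 2 ^ m}, N) \<in> nhds_order T \<one>"
    have "F m \<subseteq> \<phi> N m" for m
    proof
      fix s assume s: "s \<in> F m"
      then have sS: "s \<in> S" using F'(2) by blast
      interpret h: group_hom G add_reals "h s"
        using h(1)[OF sS] by (rule group_hom_add_reals)
      have pow: "h s (g [^] (k::nat)) = real k * h s g" if "g \<in> carrier G" for g k
        using that by (induction k) (auto simp: algebra_simps)
      have "\<bar>s x - s y\<bar> \<le> 1 / 16"
        if xy: "x \<in> topspace X" "y \<in> topspace X" and "(inv \<iota> x \<otimes> \<iota> y) [^] (2 ^ (m + 4) :: nat) \<in> N" for x y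
      proof -
        have "\<bar>h s ((inv \<iota> x \<otimes> \<iota> y) [^] (2 ^ (m + 4) :: nat))\<bar> \<le> 2 ^ m"
          using le that(3) s unfolding nhds_order_iff by blast
        moreover have "h s (inv \<iota> x \<otimes> \<iota> y) = s y - s x"
          using gen_closed xy h(2)[OF sS] by simp
        ultimately have "\<bar>2 ^ (m + 4) * (s y - s x)\<bar> \<le> 2 ^ m"
          using pow[of "inv \<iota> x \<otimes> \<iota> y"] gen_closed xy by simp
        then have "2 ^ m * (16 * \<bar>s y - s x\<bar>) \<le> 2 ^ m * 1"
          by (simp add: abs_mult power_add)
        then show ?thesis by (simp add: abs_minus_commute)
      qed
      then show "s \<in> \<phi> N m" unfolding \<phi>_def using sS by blast
    qed
    moreover have "\<phi> N m \<in> Fpow S" for m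
      using fin[OF N] unfolding \<phi>_def Fpow_def by blast
    ultimately show "(F, \<phi> N) \<in> omega_power (finite_subsets_order S)"
      using F' unfolding omega_power_finite_subsets_iff Fpow_def by blast
  next
    fix N assume "N \<in> Field (nhds_order T \<one>)"
    then show "\<phi> N \<in> Field (omega_power (finite_subsets_order S))"
      using fin unfolding Field_omega_power_finite_subsets Fpow_def \<phi>_def by blast
  qed
qed

lemma nhds_order_tukey_eq:
  assumes inf: "infinite (topspace X)" and \<tau>: "is_weight X \<tau>"
  shows "nhds_order T \<one> =\<^sub>T omega_power (finite_subsets_order (Field \<tau>))"
  unfolding tukey_eq_def
proof
  have card: "Card_order \<tau>" using \<tau> unfolding is_weight_def by blast
  have F\<tau>: "|Field \<tau>| =o \<tau>" using card by (rule card_of_Field_ordIso)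
  obtain \<B> where \<B>: "base_of_topology X \<B>" "|\<B>| =o \<tau>"
    using \<tau> unfolding is_weight_def by blast
  \<comment> \<open>Entourages are indexed by pairs of basic sets; as the base is infinite, this
    does not raise the cardinality.\<close>
  have "|\<B> \<times> \<B>| =o |\<B>|"
    using infinite_base[OF Hausdorff_X inf \<B>(1)] by (rule card_of_Times_same_infinite)
  also note \<B>(2)
  also have "\<tau> =o |Field \<tau>|" using F\<tau> by (rule ordIso_symmetric)
  finally have "|\<B> \<times> \<B>| \<le>o |Field \<tau>|" by (rule ordIso_imp_ordLeq)
  then show "nhds_order T \<one> \<le>\<^sub>T omega_power (finite_subsets_order (Field \<tau>))"
    by (rule tukey_le_trans[OF nhds_order_le_omega_power[OF \<B>(1)] omega_power_finite_subsets_mono])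
  obtain S where S: "separated_functions X S"
    "\<And>g. g \<in> unit_functions X \<Longrightarrow> \<exists>f\<in>S. \<forall>x\<in>topspace X. \<bar>f x - g x\<bar> < 1 / 3"
    by (rule maximal_separated_functions[of X]) blast
  have "S \<subseteq> unit_functions X" using S(1) unfolding separated_functions_def by blast
  from base_of_maximal_separated_functions[OF compact Hausdorff_X this S(2)]
  \<comment> \<open>The sets cut out by \<open>S\<close> form a base, so \<open>S\<close> has at
    least as many elements as the weight.\<close>
  have "\<tau> \<le>o |(\<lambda>f. {x \<in> topspace X. f x \<in> {1/2<..}}) ` S|"
    using \<tau> unfolding is_weight_def by blast
  then have "|Field \<tau>| \<le>o |S|"
    using ordLeq_transitive[OF ordIso_ordLeq_trans[OF F\<tau>] card_of_image] by blast
  then show "omega_power (finite_subsets_order (Field \<tau>)) \<le>\<^sub>T nhds_order T \<one>"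
    by (rule tukey_le_trans[OF omega_power_finite_subsets_mono omega_power_le_nhds_order[OF S(1)]])
qed

end


context compactly_generated_group
begin

text \<open>In the Hausdorff target some neighbourhood of the identity omits
  \<open>\<Phi> g\<close>; \<open>hom_basic_nhd\<close> pulls it back to a basic neighbourhood
  omitting \<open>g\<close>.\<close>

lemma separated_by_hom:
  assumes H: "topological_group H T" and \<Phi>: "\<Phi> \<in> hom G H"
    and cont: "continuous_map X T (\<lambda>x. \<Phi> (\<iota> x))"
    and g: "g \<in> carrier G" "\<Phi> g \<noteq> \<one>\<^bsub>H\<^esub>"
  shows "\<exists>U. (\<forall>n. entourage X (U n)) \<and> g \<notin> basic_nhd U"
proof -
  interpret H: topological_group H T by (rule H)
  have "\<Phi> g \<in> topspace T" "\<one>\<^bsub>H\<^esub> \<in> topspace T"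
    using hom_in_carrier[OF \<Phi> g(1)] H.topspace_eq by simp_all
  then obtain N where N: "openin T N" "\<one>\<^bsub>H\<^esub> \<in> N" "\<Phi> g \<notin> N"
    using H.Hausdorff g(2) unfolding Hausdorff_space_def disjnt_iff by metis
  obtain U where "\<And>n. entourage X (U n)" "\<And>g. g \<in> basic_nhd U \<Longrightarrow> \<Phi> g \<in> N"
    by (rule hom_basic_nhd[OF H \<Phi> cont N(1,2)]) blast
  then show ?thesis using N(3) by blast
qed

end

section \<open>Free Abelian topological groups\<close>

lemma comm_group_add_reals: "comm_group add_reals"
  by (rule group.group_comm_groupI[OF group_add_reals]) simp

lemma compactly_generated_free_Abelian_group:
  assumes "compact_space X"
  shows "compactly_generated_group (free_Abelian_group (topspace X)) X frag_of"
proof -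
  let ?A = "free_Abelian_group (topspace X)"
  interpret A: group ?A by simp
  have gen: "frag_of ` topspace X \<subseteq> carrier ?A" by auto
  show ?thesis
  proof
    show "carrier ?A \<subseteq> generate ?A (frag_of ` topspace X)"
    proof
      fix c assume "c \<in> carrier ?A"
      then have "Poly_Mapping.keys c \<subseteq> topspace X" by simp
      then show "c \<in> generate ?A (frag_of ` topspace X)"
      proof (induction c rule: frag_induction)
        case zero
        then show ?case using generate.one[of ?A] by simp
      next
        case (one x)
        then show ?case by (blast intro: generate.incl)
      next
        case (diff a b)
        have "Poly_Mapping.keys b \<subseteq> topspace X"
          using subsetD[OF A.generate_incl[OF gen] diff(2)] by simp
        then show ?case
          using generate.eng[OF diff(1) A.generate_m_inv_closed[OF gen diff(2)]]
          by (simp add: inv_free_Abelian_group)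
      qed
    qed
  qed (use assms in auto)
qed

lemma free_type_free_Abelian_group:
  assumes X: "compact_space X" "Hausdorff_space X"
  shows "free_type_group (free_Abelian_group (topspace X)) X frag_of"
proof -
  let ?A = "free_Abelian_group (topspace X)"
  interpret A: compactly_generated_group ?A X frag_of
    using X(1) by (rule compactly_generated_free_Abelian_group)
  have ext: "\<exists>h\<in>hom ?A add_reals. \<forall>x\<in>topspace X. h (frag_of x) = s x" for s
  proof -
    obtain h where "h \<in> hom ?A add_reals" "\<And>x. x \<in> topspace X \<Longrightarrow> h (frag_of x) = s x"
      by (rule comm_group.free_Abelian_group_universal[OF comm_group_add_reals, of s "topspace X"]) auto
    then show ?thesis by blast
  qed
  show ?thesis
  proof
    fix g assume g: "g \<in> carrier ?A" "g \<noteq> \<one>\<^bsub>?A\<^esub>"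
    then obtain x0 where x0: "x0 \<in> Poly_Mapping.keys g"
      by (metis keys_eq_empty equals0I one_free_Abelian_group)
    have K: "Poly_Mapping.keys g \<subseteq> topspace X" using g by simp
    \<comment> \<open>With value 1 at \<open>x0\<close> and 0 at the other generators occurring in
      \<open>g\<close>, the induced homomorphism reads off the nonzero coefficient of
      \<open>x0\<close>.\<close>
    obtain t where t: "continuous_map X euclideanreal t"
      "\<And>x. x \<in> Poly_Mapping.keys g \<Longrightarrow> t x = (if x = x0 then 1 else 0)"
      by (rule continuous_interpolation[OF X finite_keys K, of "\<lambda>x. if x = x0 then 1 else 0"]) blast
    obtain h where h: "h \<in> hom ?A add_reals" "\<And>x. x \<in> topspace X \<Longrightarrow> h (frag_of x) = t x"
      using ext[of t] by blast
    interpret h: group_hom ?A add_reals h using h(1) by (rule A.group_hom_add_reals)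
    \<comment> \<open>The induction stays among elements supported on the generators of
      \<open>g\<close>, where the values of \<open>t\<close> are known. The first conjunct provides
      membership in the group for the difference case.\<close>
    have "Poly_Mapping.keys c \<subseteq> topspace X \<and> h c = of_int (Poly_Mapping.lookup c x0)"
      if "Poly_Mapping.keys c \<subseteq> Poly_Mapping.keys g" for c
      using that
    proof (induction c rule: frag_induction)
      case zero
      then show ?case using h.hom_one by simp
    next
      case (one x)
      then show ?case using h(2)[of x] t(2)[of x] K by (auto simp: lookup_single when_def)
    next
      case (diff a b)
      have "h (a - b) = h (a \<otimes>\<^bsub>?A\<^esub> inv\<^bsub>?A\<^esub> b)" using diff(2) by simp
      also have "\<dots> = h a - h b" using diff h.hom_mult[of a "inv\<^bsub>?A\<^esub> b"] h.hom_inv[of b] by simp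
      finally show ?case
        using diff keys_diff[of a b] by (auto simp: lookup_minus)
    qed
    then have "h g \<noteq> \<one>\<^bsub>add_reals\<^esub>" using x0 by (simp add: in_keys_iff)
    moreover have "continuous_map X euclideanreal (\<lambda>x. h (frag_of x))"
      using t(1) h(2) by (simp add: continuous_map_eq)
    ultimately show "\<exists>U. (\<forall>n. entourage X (U n)) \<and> g \<notin> A.basic_nhd U"
      using A.separated_by_hom[OF topological_group_add_reals h(1) _ g(1)] by blast
  qed (use X ext in auto)
qed

section \<open>Free topological groups\<close>

text \<open>Two by two matrices listed row by row; as quadruples of reals they carry the Euclidean
  topology.\<close>

definition SL2 :: "(real \<times> real \<times> real \<times> real) monoid" where
  "SL2 = \<lparr>carrier = {(a, b, c, d). a * d - b * c = 1},
     monoid.mult = (\<lambda>(a, b, c, d) (a', b', c', d').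
       (a * a' + b * c', a * b' + b * d', c * a' + d * c', c * b' + d * d')),
     one = (1, 0, 0, 1)\<rparr>"

lemma SL2_simps:
  "(a, b, c, d) \<in> carrier SL2 \<longleftrightarrow> a * d - b * c = 1"
  "(a, b, c, d) \<otimes>\<^bsub>SL2\<^esub> (a', b', c', d') =
     (a * a' + b * c', a * b' + b * d', c * a' + d * c', c * b' + d * d')"
  "\<one>\<^bsub>SL2\<^esub> = (1, 0, 0, 1)"
  by (simp_all add: SL2_def)

lemma group_SL2: "group SL2"
proof (rule groupI)
  fix x y assume "x \<in> carrier SL2" "y \<in> carrier SL2"
  then obtain a b c d a' b' c' d' where xy: "x = (a, b, c, d)" "y = (a', b', c', d')"
    and det: "a * d - b * c = 1" "a' * d' - b' * c' = 1"
    by (cases x, cases y) (auto simp: SL2_simps)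
  have "(a * a' + b * c') * (c * b' + d * d') - (a * b' + b * d') * (c * a' + d * c') =
      (a * d - b * c) * (a' * d' - b' * c')" by algebra
  then show "x \<otimes>\<^bsub>SL2\<^esub> y \<in> carrier SL2" using det by (simp add: xy SL2_simps)
next
  fix x y z
  show "x \<otimes>\<^bsub>SL2\<^esub> y \<otimes>\<^bsub>SL2\<^esub> z = x \<otimes>\<^bsub>SL2\<^esub> (y \<otimes>\<^bsub>SL2\<^esub> z)"
    by (cases x, cases y, cases z) (simp add: SL2_simps algebra_simps)
next
  fix x assume "x \<in> carrier SL2"
  then obtain a b c d where x: "x = (a, b, c, d)" "a * d - b * c = 1"
    by (cases x) (auto simp: SL2_simps)
  show "\<exists>y\<in>carrier SL2. y \<otimes>\<^bsub>SL2\<^esub> x = \<one>\<^bsub>SL2\<^esub>"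
    using x by (intro bexI[of _ "(d, - b, - c, a)"]) (auto simp: SL2_simps algebra_simps)
qed (auto simp: SL2_simps)

lemma inv_SL2:
  assumes "(a, b, c, d) \<in> carrier SL2"
  shows "inv\<^bsub>SL2\<^esub> (a, b, c, d) = (d, - b, - c, a)"
  by (rule group.inv_equality[OF group_SL2]) (use assms in \<open>auto simp: SL2_simps algebra_simps\<close>)

lemma topological_group_SL2: "topological_group SL2 (top_of_set (carrier SL2))"
proof (intro topological_group.intro group_SL2 topological_group_axioms.intro)
  let ?C = "carrier SL2"
  interpret SL2: group SL2 by (rule group_SL2)
  have "continuous_on (?C \<times> ?C) (\<lambda>(x, y). x \<otimes>\<^bsub>SL2\<^esub> y)"
    unfolding SL2_def monoid.simps case_prod_unfold by (intro continuous_intros)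
  then show "continuous_map (prod_topology (top_of_set ?C) (top_of_set ?C)) (top_of_set ?C)
      (\<lambda>(x, y). x \<otimes>\<^bsub>SL2\<^esub> y)"
    by (auto simp: subtopology_Times[symmetric] continuous_map_in_subtopology)
  have "continuous_on ?C (\<lambda>(a, b, c, d). (d, - b, - c, a))"
    unfolding case_prod_unfold by (intro continuous_intros)
  moreover have "(\<lambda>(a, b, c, d). (d, - b, - c, a)) x = inv\<^bsub>SL2\<^esub> x" if "x \<in> ?C" for x
    using that inv_SL2 by (cases x) auto
  ultimately have "continuous_on ?C (\<lambda>x. inv\<^bsub>SL2\<^esub> x)"
    by (simp cong: continuous_on_cong)
  then show "continuous_map (top_of_set ?C) (top_of_set ?C) (\<lambda>x. inv\<^bsub>SL2\<^esub> x)"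
    by (auto simp: continuous_map_in_subtopology)
  show "Hausdorff_space (top_of_set ?C)"
    by (simp add: Hausdorff_space_subtopology)
qed simp

section \<open>Letters and generators of the free group\<close>

lemma inv_free_gen:
  assumes "x \<in> S"
  shows "inv\<^bsub>free_group S\<^esub> free_gen x = [(x, False)]"
proof (rule group.inv_equality[OF group_free_group])
  show "[(x, False)] \<otimes>\<^bsub>free_group S\<^esub> free_gen x = \<one>\<^bsub>free_group S\<^esub>"
    by (simp add: free_group_def free_gen_def push_letter_def flip_letter_def)
qed (use assms in \<open>auto simp: free_group_def free_gen_def reduced_Cons\<close>)

lemma free_group_Cons:
  assumes "a # w \<in> carrier (free_group S)"
  shows "fst a \<in> S" "w \<in> carrier (free_group S)" "[a] \<in> carrier (free_group S)"
    "a # w = [a] \<otimes>\<^bsub>free_group S\<^esub> w"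
  using assms by (auto simp: free_group_def reduced_Cons push_letter_def)

lemma compactly_generated_free_group:
  assumes "compact_space X"
  shows "compactly_generated_group (free_group (topspace X)) X free_gen"
proof -
  let ?F = "free_group (topspace X)"
  interpret F: group ?F by (rule group_free_group)
  have gen: "free_gen x \<in> carrier ?F" if "x \<in> topspace X" for x
    using that by (simp add: free_group_def free_gen_def reduced_Cons)
  show ?thesis
  proof
    show "carrier ?F \<subseteq> generate ?F (free_gen ` topspace X)"
    proof
      fix w assume "w \<in> carrier ?F"
      then show "w \<in> generate ?F (free_gen ` topspace X)"
      proof (induction w)
        case Nil
        then show ?case using generate.one[of ?F] by (simp add: free_group_def)
      next
        case (Cons a w)
        note a = free_group_Cons[OF Cons.prems]
        have "[a] \<in> generate ?F (free_gen ` topspace X)"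
        proof (cases "snd a")
          case True
          then have "[a] = free_gen (fst a)" by (cases a) (simp add: free_gen_def)
          then show ?thesis using a(1) by (auto intro: generate.incl)
        next
          case False
          then have "[a] = inv\<^bsub>?F\<^esub> free_gen (fst a)"
            using inv_free_gen[OF a(1)] by (cases a) simp
          then show ?thesis using a(1) by (auto intro: generate.inv)
        qed
        then show ?case using a(4) generate.eng[OF _ Cons.IH[OF a(2)]] by metis
      qed
    qed
  qed (use assms gen in auto)
qed

section \<open>Ping-pong on the plane\<close>

fun act :: "real \<times> real \<times> real \<times> real \<Rightarrow> real \<times> real \<Rightarrow> real \<times> real" where
  "act (a, b, c, d) (p, q) = (a * p + b * q, c * p + d * q)"

lemma act_mult: "act (x \<otimes>\<^bsub>SL2\<^esub> y) v = act x (act y v)"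
  by (cases x, cases y, cases v) (simp add: SL2_simps algebra_simps)

text \<open>The conjugate of the matrix with rows \<open>(1, 0)\<close>, \<open>(2, 1)\<close> by the one with rows
  \<open>(1, 2t)\<close>, \<open>(0, 1)\<close>. The path joins the free generators obtained for integers \<open>t\<close>.\<close>

definition free_path :: "real \<Rightarrow> real \<times> real \<times> real \<times> real" where
  "free_path t = (1 + 4 * t, - 8 * t\<^sup>2, 2, 1 - 4 * t)"

lemma free_path_closed: "free_path t \<in> carrier SL2"
  by (simp add: free_path_def SL2_simps power2_eq_square algebra_simps)

text \<open>Ping-pong: in the coordinates \<open>(p - 2 t q, q)\<close> the letter of parameter \<open>t\<close> is
  \<open>(u, q) \<mapsto> (u, q \<plusminus> 2 u)\<close>, so afterwards \<open>q\<close> dominates \<open>u\<close>, with a sign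
  that tells the letter from its inverse.\<close>

lemma ping_pong:
  fixes t :: "'a \<Rightarrow> real"
  assumes \<Phi>: "\<Phi> \<in> hom (free_group S) SL2" "\<And>x. x \<in> S \<Longrightarrow> \<Phi> (free_gen x) = free_path (t x)"
    and w: "w \<in> carrier (free_group S)" "w \<noteq> []"
    and far: "\<And>x y. \<lbrakk>x \<in> fst ` set w; y \<in> fst ` set w; x \<noteq> y\<rbrakk> \<Longrightarrow> \<bar>t x - t y\<bar> \<ge> 1"
  shows "\<Phi> w \<noteq> \<one>\<^bsub>SL2\<^esub>"
proof -
  interpret F: group "free_group S" by (rule group_free_group)
  interpret \<Phi>: group_hom "free_group S" SL2 \<Phi>
    using \<Phi>(1) by (intro group_hom.intro group_hom_axioms.intro F.is_group group_SL2)
  have pos: "act (\<Phi> [(x, True)]) (p, q) = (p + 4 * t x * (p - 2 * t x * q), q + 2 * (p - 2 * t x * q))"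
    if "x \<in> S" for x p q
    using \<Phi>(2)[OF that] by (simp add: free_gen_def free_path_def power2_eq_square algebra_simps)
  have neg: "act (\<Phi> [(x, False)]) (p, q) = (p - 4 * t x * (p - 2 * t x * q), q - 2 * (p - 2 * t x * q))"
    if "x \<in> S" for x p q
  proof -
    have "free_gen x \<in> carrier (free_group S)"
      using that by (simp add: free_group_def free_gen_def reduced_Cons)
    then have "\<Phi> [(x, False)] = inv\<^bsub>SL2\<^esub> free_path (t x)"
      using \<Phi>.hom_inv[of "free_gen x"] \<Phi>(2)[OF that] inv_free_gen[OF that] by simp
    also have "\<dots> = (1 - 4 * t x, 8 * (t x)\<^sup>2, - 2, 1 + 4 * t x)"
      using inv_SL2 free_path_closed[of "t x"] by (simp add: free_path_def)
    finally show ?thesis by (simp add: power2_eq_square algebra_simps)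
  qed
  \<comment> \<open>With \<open>u = p - 2 * t (fst a) * q\<close>, the region of the letter
    \<open>a\<close> is \<open>\<bar>u\<bar> \<le> \<bar>q\<bar>\<close> with \<open>u * q\<close>
    nonnegative for a generator and nonpositive for an inverse. The vector \<open>(1, 0)\<close> has
    \<open>q = 0\<close> and \<open>u = 1\<close>, so it lies in no region.\<close>
  define inside where "inside a v \<longleftrightarrow> (case v of (p, q) \<Rightarrow>
      \<bar>p - 2 * t (fst a) * q\<bar> \<le> \<bar>q\<bar> \<and>
      (if snd a then 0 \<le> p - 2 * t (fst a) * q \<and> 0 \<le> q \<or> p - 2 * t (fst a) * q \<le> 0 \<and> q \<le> 0
       else 0 \<le> p - 2 * t (fst a) * q \<and> q \<le> 0 \<or> p - 2 * t (fst a) * q \<le> 0 \<and> 0 \<le> q))"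
    for a :: "'a \<times> bool" and v :: "real \<times> real"
  have letter: "inside a (act (\<Phi> [a]) v)"
    if a: "fst a \<in> S" and v: "v = (1, 0) \<or> (\<exists>b. inside b v \<and> b \<noteq> flip_letter a \<and> (fst b \<noteq> fst a \<longrightarrow> \<bar>t (fst b) - t (fst a)\<bar> \<ge> 1))"
    for a v
  proof -
    obtain x e where xe: "a = (x, e)" by (cases a)
    obtain p q where pq: "v = (p, q)" by (cases v)
    define u where "u = p - 2 * t x * q"
    \<comment> \<open>The position before \<open>a\<close> acts. In a reduced word a preceding
      letter with the same generator is \<open>a\<close> itself, so the vector is already in the
      region of \<open>a\<close>; otherwise \<open>u\<close> dominates \<open>q\<close>.\<close>
    have start: "\<bar>u\<bar> \<ge> \<bar>q\<bar> \<or> inside a v"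
      using v
    proof
      assume "v = (1, 0)"
      then show ?thesis by (simp add: pq u_def)
    next
      assume "\<exists>b. inside b v \<and> b \<noteq> flip_letter a \<and> (fst b \<noteq> fst a \<longrightarrow> \<bar>t (fst b) - t (fst a)\<bar> \<ge> 1)"
      then obtain b where b: "inside b v" "b \<noteq> flip_letter a" "fst b \<noteq> fst a \<Longrightarrow> \<bar>t (fst b) - t (fst a)\<bar> \<ge> 1"
        by blast
      show ?thesis
      proof (cases "fst b = x")
        case True
        then have "b = a" using b(2) by (cases b) (auto simp: xe flip_letter_def)
        then show ?thesis using b(1) by simp
      next
        case False
        \<comment> \<open>Passing from the coordinate for \<open>b\<close> to that for
          \<open>a\<close> adds a term of size at least \<open>2 * \<bar>q\<bar>\<close>, while the
          coordinate for \<open>b\<close> is at most \<open>\<bar>q\<bar>\<close>.\<close>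
        then have "1 * \<bar>q\<bar> \<le> \<bar>t (fst b) - t x\<bar> * \<bar>q\<bar>"
          using b(3) by (intro mult_right_mono) (auto simp: xe)
        also have "\<dots> = \<bar>(t (fst b) - t x) * q\<bar>" by (simp add: abs_mult)
        finally have "2 * \<bar>q\<bar> \<le> \<bar>2 * ((t (fst b) - t x) * q)\<bar>" by simp
        moreover have "\<bar>p - 2 * t (fst b) * q\<bar> \<le> \<bar>q\<bar>"
          using b(1) by (simp add: inside_def pq)
        moreover have "u = p - 2 * t (fst b) * q + 2 * ((t (fst b) - t x) * q)"
          by (simp add: u_def algebra_simps)
        ultimately show ?thesis by linarith
      qed
    qed
    show ?thesis
    proof (cases e)
      case True
      have act: "act (\<Phi> [a]) v = (p + 4 * t x * u, q + 2 * u)"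
        using pos[of x p q] a by (simp add: xe pq True u_def)
      have u: "p + 4 * t x * u - 2 * t x * (q + 2 * u) = u"
        by (simp add: u_def algebra_simps)
      \<comment> \<open>If \<open>u\<close> dominates \<open>q\<close>, then \<open>2 * u\<close>
        fixes the sign of the sum and leaves at least \<open>\<bar>u\<bar>\<close>; if the signs
        agree, nothing cancels.\<close>
      have "\<bar>u\<bar> \<le> \<bar>q + 2 * u\<bar> \<and> (0 \<le> u \<and> 0 \<le> q + 2 * u \<or> u \<le> 0 \<and> q + 2 * u \<le> 0)"
      proof -
        have "\<bar>u\<bar> \<ge> \<bar>q\<bar> \<or> 0 \<le> u \<and> 0 \<le> q \<or> u \<le> 0 \<and> q \<le> 0"
          using start unfolding inside_def xe pq u_def by (auto simp: True)
        then show ?thesis by (smt (verit))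
      qed
      then show ?thesis unfolding inside_def act prod.case unfolding xe fst_conv snd_conv u by (simp add: True)
    next
      case False
      have act: "act (\<Phi> [a]) v = (p - 4 * t x * u, q - 2 * u)"
        using neg[of x p q] a by (simp add: xe pq False u_def)
      have u: "p - 4 * t x * u - 2 * t x * (q - 2 * u) = u"
        by (simp add: u_def algebra_simps)
      have "\<bar>u\<bar> \<le> \<bar>q - 2 * u\<bar> \<and> (0 \<le> u \<and> q - 2 * u \<le> 0 \<or> u \<le> 0 \<and> 0 \<le> q - 2 * u)"
      proof -
        have "\<bar>u\<bar> \<ge> \<bar>q\<bar> \<or> 0 \<le> u \<and> q \<le> 0 \<or> u \<le> 0 \<and> 0 \<le> q"
          using start unfolding inside_def xe pq u_def by (auto simp: False)
        then show ?thesis by (smt (verit))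
      qed
      then show ?thesis unfolding inside_def act prod.case unfolding xe fst_conv snd_conv u by (simp add: False)
    qed
  qed
  \<comment> \<open>The last letter acts first, on \<open>(1, 0)\<close>; the head acts last and
    decides the final region.\<close>
  have "inside (hd w) (act (\<Phi> w) (1, 0))"
    using w far
  proof (induction w)
    case (Cons a w)
    note aw = free_group_Cons[OF Cons.prems(1)]
    note IH = Cons.IH[OF aw(2)] and red = Cons.prems(1) and far = Cons.prems(3)
    have "\<Phi> (a # w) = \<Phi> [a] \<otimes>\<^bsub>SL2\<^esub> \<Phi> w"
      unfolding aw(4) by (rule \<Phi>.hom_mult[OF aw(3,2)])
    then have split: "act (\<Phi> (a # w)) (1, 0) = act (\<Phi> [a]) (act (\<Phi> w) (1, 0))"
      by (simp add: act_mult)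
    have "act (\<Phi> w) (1, 0) = (1, 0) \<or> (\<exists>b. inside b (act (\<Phi> w) (1, 0)) \<and> b \<noteq> flip_letter a \<and>
        (fst b \<noteq> fst a \<longrightarrow> \<bar>t (fst b) - t (fst a)\<bar> \<ge> 1))"
    proof (cases w)
      case Nil
      then have "\<Phi> w = (1, 0, 0, 1)"
        using \<Phi>.hom_one by (simp add: free_group_def SL2_simps)
      then show ?thesis by simp
    next
      case w: (Cons b w')
      have "inside (hd w) (act (\<Phi> w) (1, 0))"
      proof (rule IH)
        show "w \<noteq> []" using w by simp
        fix x y assume "x \<in> fst ` set w" "y \<in> fst ` set w" "x \<noteq> y"
        then show "\<bar>t x - t y\<bar> \<ge> 1" by (intro far) auto
      qed
      moreover have "b \<noteq> flip_letter a"
        using red w by (auto simp: free_group_def reduced_Cons)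
      moreover have "fst b \<noteq> fst a \<longrightarrow> \<bar>t (fst b) - t (fst a)\<bar> \<ge> 1"
        using far[of "fst b" "fst a"] w by simp
      ultimately show ?thesis using w by (intro disjI2 exI[of _ b]) simp
    qed
    then show ?case unfolding split list.sel by (rule letter[OF aw(1)])
  qed simp
  moreover have "\<not> inside a (1, 0)" for a
    by (simp add: inside_def)
  moreover have "act \<one>\<^bsub>SL2\<^esub> (1, 0) = (1, 0)" by (simp add: SL2_simps)
  ultimately show ?thesis by metis
qed

lemma free_type_free_group:
  assumes X: "compact_space X" "Hausdorff_space X"
  shows "free_type_group (free_group (topspace X)) X free_gen"
proof -
  let ?F = "free_group (topspace X)"
  interpret F: compactly_generated_group ?F X free_gen
    using X(1) by (rule compactly_generated_free_group)
  show ?thesis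
  proof
    fix w assume w: "w \<in> carrier ?F" "w \<noteq> \<one>\<^bsub>?F\<^esub>"
    then have "w \<noteq> []" by (simp add: free_group_def)
    let ?K = "fst ` set w"
    have K: "finite ?K" "?K \<subseteq> topspace X" using w(1) by (auto simp: free_group_def)
    \<comment> \<open>Numbering the letters of \<open>w\<close> gives parameters at distance at
      least 1, as \<open>ping_pong\<close> requires. Interpolating them continuously over
      \<open>X\<close> is why \<open>free_path\<close> takes real arguments.\<close>
    obtain f :: "'a \<Rightarrow> nat" where f: "inj_on f ?K"
      using finite_imp_inj_to_nat_seg[OF K(1)] by blast
    obtain t where t: "continuous_map X euclideanreal t" "\<And>x. x \<in> ?K \<Longrightarrow> t x = real (f x)"
      by (rule continuous_interpolation[OF X K, of "\<lambda>x. real (f x)"]) blast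
    have "(\<lambda>x. free_path (t x)) \<in> topspace X \<rightarrow> carrier SL2"
      using free_path_closed by blast
    then obtain \<Phi> where \<Phi>: "\<Phi> \<in> hom ?F SL2" "\<And>x. x \<in> topspace X \<Longrightarrow> \<Phi> (free_gen x) = free_path (t x)"
      using free_group_universal(1)[OF group_SL2] by metis
    have "\<bar>t x - t y\<bar> \<ge> 1" if "x \<in> ?K" "y \<in> ?K" "x \<noteq> y" for x y
    proof -
      have "f x \<noteq> f y" using f that by (auto dest: inj_onD)
      then show ?thesis using t(2) that by (cases "f x < f y") auto
    qed
    then have "\<Phi> w \<noteq> \<one>\<^bsub>SL2\<^esub>"
      using ping_pong[OF \<Phi> w(1) \<open>w \<noteq> []\<close>] by blast
    moreover have "continuous_map X (top_of_set (carrier SL2)) (\<lambda>x. \<Phi> (free_gen x))"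
    proof -
      have "continuous_on UNIV free_path"
        unfolding free_path_def by (intro continuous_intros)
      then have "continuous_map euclideanreal (top_of_set (carrier SL2)) free_path"
        using free_path_closed by (auto simp: continuous_map_in_subtopology)
      from continuous_map_compose[OF t(1) this]
      show ?thesis using \<Phi>(2) by (simp add: o_def continuous_map_eq)
    qed
    ultimately show "\<exists>U. (\<forall>n. entourage X (U n)) \<and> w \<notin> F.basic_nhd U"
      using F.separated_by_hom[OF topological_group_SL2 \<Phi>(1) _ w(1)] by blast
  next
    fix s :: "'a \<Rightarrow> real"
    have "s \<in> topspace X \<rightarrow> carrier add_reals" by simp
    then show "\<exists>h\<in>hom ?F add_reals. \<forall>x\<in>topspace X. h (free_gen x) = s x"
      by (rule free_group_universal(1)[OF group_add_reals])
  qed (use X in auto)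
qed

theorem corollary3p10:
  fixes X :: "'a topology" and \<tau> :: "'t rel"
  assumes "compact_space X" and "Hausdorff_space X" and "infinite (topspace X)"
    and "is_weight X \<tau>"
  shows "nhds_order (markov_free_topology X) \<one>\<^bsub>free_group (topspace X)\<^esub>
           =\<^sub>T nhds_order (markov_free_abelian_topology X) \<one>\<^bsub>free_Abelian_group (topspace X)\<^esub> \<and>
         nhds_order (markov_free_abelian_topology X) \<one>\<^bsub>free_Abelian_group (topspace X)\<^esub>
           =\<^sub>T omega_power (finite_subsets_order (Field \<tau>))"
proof -
  note F = free_type_group.nhds_order_tukey_eq[OF free_type_free_group[OF assms(1,2)] assms(3,4)]
  note A = free_type_group.nhds_order_tukey_eq[OF free_type_free_Abelian_group[OF assms(1,2)] assms(3,4)]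
  from F A show ?thesis
    unfolding markov_free_topology_def markov_free_abelian_topology_def tukey_eq_def
    by (meson tukey_le_trans)
qed

end
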